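(* There is a $\mathfrak{T}$-orbit of $3$-dimensional algebraic varieties in $\mathbb{C}^3\times\mathbb{C}^2$ with the gamma quotient summation property, which up to separate permutations of upper and lower parameters comprises exactly three varieties, which are not $3$-planes. They correspond to the following quadratically constrained identities (the three varieties being the sets of $(a,b,c;d,e)$ satisfying the respective parametric constraints). (i) If $ab+bc+ca=(d-1)(e-1)$ and $d+e-a-b-c=2$, then $${}_3F_2\left(\begin{array}{c}a,\,b,\,c\\ d,\,e\end{array}\right)=\frac{\Gamma(d)\Gamma(e)}{\Gamma(a+1)\Gamma(b+1)\Gamma(c+1)}.$$ (ii) If $(a-1)(b-1)=[(a-1)+(b-1)-(e-1)]\,c$, then $${}_3F_2\left(\begin{array}{c}a,\,b,\,c\\ c+2,\,e\end{array}\right)=\frac{\Gamma(e)\,\Gamma(e-a-b+2)\,\Gamma(c+2)}{\Gamma(e-a+1)\,\Gamma(e-b+1)\,\Gamma(c+1)},$$ provided $\operatorname{Re}(e-a-b+2)>0$. (iii) If $(a-1)(b-1)=(d-2)(e-2)$, then $${}_3F_2\left(\begin{array}{c}a,\,b,\,2\\ d,\,e\end{array}\right)=\frac{(d-1)(e-1)}{d+e-a-b-2},$$ provided $\operatorname{Re}(d+e-a-b-2)>0$. In each identity, it is assumed that no lower parameter is a non-positive integer.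
   Context: ${}_3F_2\left(\begin{array}{c}a,b,c\\ d,e\end{array}\right)$ means the hypergeometric series at argument $1$: $\sum_{k\ge0}\frac{(a)_k(b)_k(c)_k}{(d)_k(e)_k\,k!}$, where $(a)_k=a(a+1)\cdots(a+k-1)$, $(a)_0=1$; it converges if $\operatorname{Re}(d+e-a-b-c)>0$. Points of $\mathbb{C}^3\times\mathbb{C}^2$ are written $(a,b,c;d,e)$, with $a,b,c$ the upper and $d,e$ the lower parameters. A $3$-plane is a $3$-dimensional affine subspace. "Separate permutations of upper and lower parameters" means the action of $S_3\times S_2$ permuting $a,b,c$ among themselves and $d,e$ among themselves. A gamma quotient is an expression $\Gamma(p_1)\cdots\Gamma(p_m)/(\Gamma(q_1)\cdots\Gamma(q_n))$; one with a denominator argument equal to a non-positive integer is interpreted as zero. An algebraic variety $\mathcal{V}\subset\mathbb{C}^3\times\mathbb{C}^2$ has the gamma quotient summation property if for all $(a,b,c;d,e)\in\mathcal{V}$ (subject to $\operatorname{Re}(d+e-a-b-c)>0$ and neither $d$ nor $e$ being a non-positive integer), ${}_3F_2\left(\begin{array}{c}a,b,c\\ d,e\end{array}\right)$ sums to a gamma quotient, the arguments of which are affine functions, with rational coefficients, of $a,b,c,d,e$. The Thomae group $\mathfrak{T}\subset GL(5,\mathbb{C})$, isomorphic to $S_5$, is defined as follows. Introduce new linear coordinates $(x,y,z;u,v)$ on $\mathbb{C}^3\times\mathbb{C}^2$ by $(a,b,c;d,e)=(x,y,z;u,v)A$ (row vectors), with $$A=\begin{pmatrix}1&0&0&1&1\\0&1&0&1&1\\0&0&1&1&1\\1&1&1&2&1\\1&1&1&1&2\end{pmatrix}.$$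 $\mathfrak{T}$ is the group of linear transformations of $\mathbb{C}^3\times\mathbb{C}^2$ induced by all $5!$ permutations of the five coordinates $x,y,z,u,v$. Permutations of $x,y,z$ and of $u,v$ correspond to separate permutations of $a,b,c$ and of $d,e$. *)

theory Defs
  imports "HOL-Analysis.Analysis"
begin

section \<open>Affine algebraic varieties\<close>

text \<open>Over the infinite field of complex numbers, polynomials and polynomial functions coincide,
  so multivariate polynomials are represented by the functions they induce.\<close>

inductive_set polynomial_functions :: "((complex^'n \<Rightarrow> complex)) set" where
  const: "(\<lambda>p. c) \<in> polynomial_functions"
| coord: "(\<lambda>p. p $ i) \<in> polynomial_functions"
| add: "f \<in> polynomial_functions \<Longrightarrow> g \<in> polynomial_functions
          \<Longrightarrow> (\<lambda>p. f p + g p) \<in> polynomial_functions"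
| mult: "f \<in> polynomial_functions \<Longrightarrow> g \<in> polynomial_functions
          \<Longrightarrow> (\<lambda>p. f p * g p) \<in> polynomial_functions"

definition zariski_closed :: "(complex^'n) set \<Rightarrow> bool" where
  "zariski_closed V \<longleftrightarrow> (\<exists>F \<subseteq> polynomial_functions. V = {p. \<forall>f\<in>F. f p = 0})"

text \<open>Varieties are irreducible by convention.\<close>

definition algebraic_variety :: "(complex^'n) set \<Rightarrow> bool" where
  "algebraic_variety V \<longleftrightarrow> zariski_closed V \<and> V \<noteq> {} \<and>
     (\<forall>X Y. zariski_closed X \<longrightarrow> zariski_closed Y \<longrightarrow> V = X \<union> Y \<longrightarrow> V = X \<or> V = Y)"

text \<open>Krull dimension: the supremum of the lengths \<open>n\<close> of chains
  \<open>Z 0 \<subset> Z 1 \<subset> \<dots> \<subset> Z n\<close> of irreducible closed subsets.\<close>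

definition variety_dim :: "(complex^'n) set \<Rightarrow> enat" where
  "variety_dim V = Sup {enat n | n. \<exists>Z :: nat \<Rightarrow> (complex^'n) set.
     (\<forall>i\<le>n. algebraic_variety (Z i) \<and> Z i \<subseteq> V) \<and> (\<forall>i<n. Z i \<subset> Z (Suc i))}"

text \<open>Here \<open>vec.subspace\<close> and \<open>vec.dim\<close> refer to the vector space structure over the complex
  numbers (not over the reals, as \<open>subspace\<close> and \<open>dim\<close> would).\<close>

definition three_plane :: "(complex^'n) set \<Rightarrow> bool" where
  "three_plane W \<longleftrightarrow> (\<exists>S p. vec.subspace S \<and> vec.dim S = 3 \<and> W = (+) p ` S)"


section \<open>Parameter space and Thomae group\<close>

text \<open>The point \<open>(a,b,c;d,e)\<close> of the parameter space is \<open>vector [a,b,c,d,e] :: complex^5\<close>.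
  Its components are indexed by the numerals \<open>1\<close> to \<open>5\<close> of the index type \<open>5\<close>.\<close>

definition thomae_matrix :: "complex^5^5" where
  "thomae_matrix = vector
     [vector [1, 0, 0, 1, 1],
      vector [0, 1, 0, 1, 1],
      vector [0, 0, 1, 1, 1],
      vector [1, 1, 1, 2, 1],
      vector [1, 1, 1, 1, 2]]"

text \<open>Since \<open>thomae_matrix\<close> is invertible, each permutation determines exactly one map \<open>g\<close>,
  and this map is linear and bijective.\<close>

definition thomae_group :: "(complex^5 \<Rightarrow> complex^5) set" where
  "thomae_group = {g. \<exists>\<sigma>. \<sigma> permutes (UNIV :: 5 set) \<and>
     (\<forall>w :: complex^5. g (w v* thomae_matrix) = (\<chi> i. w $ \<sigma> i) v* thomae_matrix)}"

definition thomae_orbit :: "(complex^5) set \<Rightarrow> (complex^5) set set" where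
  "thomae_orbit V = (\<lambda>g. g ` V) ` thomae_group"

definition separate_permutations :: "(complex^5 \<Rightarrow> complex^5) set" where
  "separate_permutations = {(\<lambda>p. \<chi> i. p $ \<sigma> i) | \<sigma>.
     \<sigma> permutes (UNIV :: 5 set) \<and> \<sigma> ` {1, 2, 3} = {1, 2, 3} \<and> \<sigma> ` {4, 5} = {4, 5}}"

definition separate_perm_rel :: "((complex^5) set \<times> (complex^5) set) set" where
  "separate_perm_rel = {(V, W). \<exists>h \<in> separate_permutations. W = h ` V}"


section \<open>Hypergeometric series and gamma quotients\<close>

definition hyp3F2_term :: "complex \<Rightarrow> complex \<Rightarrow> complex \<Rightarrow> complex \<Rightarrow> complex \<Rightarrow> nat \<Rightarrow> complex" where
  "hyp3F2_term a b c d e k =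
     pochhammer a k * pochhammer b k * pochhammer c k /
     (pochhammer d k * pochhammer e k * fact k)"

definition gamma_quotient :: "complex list \<Rightarrow> complex list \<Rightarrow> complex" where
  "gamma_quotient ps qs =
     (if \<exists>q \<in> set qs. q \<in> \<int>\<^sub>\<le>\<^sub>0 then 0
      else prod_list (map Gamma ps) / prod_list (map Gamma qs))"

text \<open>A gamma quotient has no meaning if some numerator argument, but no denominator argument,
  is a pole of the gamma function; the library's \<open>Gamma\<close> silently takes the value \<open>0\<close> there.\<close>

definition gamma_quotient_defined :: "complex list \<Rightarrow> complex list \<Rightarrow> bool" where
  "gamma_quotient_defined ps qs \<longleftrightarrow>
     (\<exists>q \<in> set qs. q \<in> \<int>\<^sub>\<le>\<^sub>0) \<or> (\<forall>p \<in> set ps. p \<notin> \<int>\<^sub>\<le>\<^sub>0)"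

definition rat_affine_functions :: "(complex^5 \<Rightarrow> complex) set" where
  "rat_affine_functions =
     {(\<lambda>p. of_rat r + (\<Sum>i\<in>UNIV. of_rat (m $ i) * p $ i)) | (r :: rat) (m :: rat^5). True}"

text \<open>The lists \<open>P\<close> and \<open>Q\<close> of affine functions are chosen uniformly for all points of \<open>V\<close>.\<close>

definition gamma_quotient_summation :: "(complex^5) set \<Rightarrow> bool" where
  "gamma_quotient_summation V \<longleftrightarrow>
     (\<exists>P Q. set P \<subseteq> rat_affine_functions \<and> set Q \<subseteq> rat_affine_functions \<and>
       (\<forall>a b c d e. vector [a, b, c, d, e] \<in> V \<longrightarrow> Re (d + e - a - b - c) > 0 \<longrightarrow>
          d \<notin> \<int>\<^sub>\<le>\<^sub>0 \<longrightarrow> e \<notin> \<int>\<^sub>\<le>\<^sub>0 \<longrightarrow>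
          (let ps = map (\<lambda>f. f (vector [a, b, c, d, e])) P;
               qs = map (\<lambda>f. f (vector [a, b, c, d, e])) Q
           in gamma_quotient_defined ps qs \<and>
              hyp3F2_term a b c d e sums gamma_quotient ps qs)))"


section \<open>The three quadratically constrained varieties\<close>

definition variety_i :: "(complex^5) set" where
  "variety_i = {vector [a, b, c, d, e] | a b c d e.
     a * b + b * c + c * a = (d - 1) * (e - 1) \<and> d + e - a - b - c = 2}"

definition variety_ii :: "(complex^5) set" where
  "variety_ii = {vector [a, b, c, c + 2, e] | a b c e.
     (a - 1) * (b - 1) = ((a - 1) + (b - 1) - (e - 1)) * c}"

definition variety_iii :: "(complex^5) set" where
  "variety_iii = {vector [a, b, 2, d, e] | a b d e.
     (a - 1) * (b - 1) = (d - 2) * (e - 2)}"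

end

theory Submission
  imports Defs
begin

text \<open>The three identities rest on telescoping. In (i) the partial sums are the quotients
  \<open>(a+1)\<^sub>n(b+1)\<^sub>n(c+1)\<^sub>n / ((d)\<^sub>n(e)\<^sub>n n!)\<close>; in (iii) the terms are differences of
  \<open>(a)\<^sub>n(b)\<^sub>n / ((d)\<^bsub>n-1\<^esub>(e)\<^bsub>n-1\<^esub>)\<close> up to a constant factor; in (ii) the terms differ by such
  differences from \<open>c + 1\<close> times those of Gauss's series with parameters \<open>a - 1, b - 1; e\<close>. The limits
  follow from Euler's product for the gamma function.

  In the coordinates \<open>(x, y, z; u, v)\<close> variety (i) is given by \<open>x + y + z = 2\<close> and
  \<open>xy + yz + zx + u\<^sup>2 + uv + v\<^sup>2 + u + v = 1\<close>, which is symmetric in \<open>x, y, z\<close> and in \<open>u, v\<close>. Hence its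
  orbit is indexed by the three-element subsets \<open>T\<close> of the coordinates, and the size of
  \<open>T \<inter> {x, y, z}\<close> separates the classes under separate permutations. Each member is affinely
  equivalent to the cone \<open>p\<^sub>2 p\<^sub>3 = p\<^sub>4 p\<^sub>5\<close> in four-space; its dimension is bounded by counting
  polynomial functions of bounded degree.\<close>

section \<open>Gauss's summation theorem\<close>

text \<open>Each telescoping reduces to a polynomial identity in the summation index, and the
  constraints of the three varieties are exactly what makes this identity hold. Closed forms are
  expressed by the entire function \<open>rGamma\<close>, so upper parameters at poles of the gamma
  function require no separate case. The summation property is established by direct summation on
  three representatives and then moved along separate permutations, under which the series is
  symmetric term by term. Irreducibility, dimension and the failure to be a plane are invariant
  under affine bijections, so proving them for the cone settles the whole orbit. The upper bound for
  the dimension is the hard part, because the chains in its definition consist of arbitrary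
  irreducible closed sets: all that a strict inclusion provides is one polynomial function vanishing
  on the smaller set only, and the count has to work with such functions of unknown degree.\<close>

lemma pochhammer_nonzero:
  fixes z :: complex
  assumes "z \<notin> \<int>\<^sub>\<le>\<^sub>0"
  shows "pochhammer z n \<noteq> 0"
  using assms by (auto simp: pochhammer_eq_0_iff)

lemma not_nonpos_Ints_add_of_nat:
  fixes z :: complex
  assumes "z \<notin> \<int>\<^sub>\<le>\<^sub>0"
  shows "z + of_nat n \<notin> \<int>\<^sub>\<le>\<^sub>0" "z + of_nat n \<noteq> 0" "z \<noteq> 0" "z + 1 \<notin> \<int>\<^sub>\<le>\<^sub>0"
proof -
  show *: "z + of_nat n \<notin> \<int>\<^sub>\<le>\<^sub>0" for n
    using assms by (metis nonpos_Ints_diff_Nats add_diff_cancel_right' of_nat_in_Nats)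
  show "z + of_nat n \<noteq> 0" using *[of n] by auto
  show "z \<noteq> 0" using assms by auto
  show "z + 1 \<notin> \<int>\<^sub>\<le>\<^sub>0" using *[of 1] by simp
qed

section \<open>Euler's product and limits of Pochhammer quotients\<close>

lemma not_nonpos_Ints_if_Re_pos: "Re z > 0 \<Longrightarrow> z \<notin> \<int>\<^sub>\<le>\<^sub>0"
  by (auto elim!: nonpos_Ints_cases)

text \<open>Euler's product: \<open>rGamma_series z n\<close> is \<open>pochhammer z (Suc n)\<close>
  divided by \<open>n!\<close> and by \<open>n\<close> to the power \<open>z\<close>, the power
  being written as an exponential of \<open>ln n\<close>. With three factors above and three below
  the factorials cancel and the powers of \<open>n\<close> combine. Having \<open>rGamma\<close> in
  the limit admits arbitrary \<open>a\<close>, \<open>b\<close>, \<open>c\<close>.\<close>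

lemma pochhammer_quotient_times_exp_tendsto:
  fixes a b c d e f :: complex
  assumes "d \<notin> \<int>\<^sub>\<le>\<^sub>0" "e \<notin> \<int>\<^sub>\<le>\<^sub>0" "f \<notin> \<int>\<^sub>\<le>\<^sub>0"
  shows "(\<lambda>n. pochhammer a (Suc n) * pochhammer b (Suc n) * pochhammer c (Suc n) /
              (pochhammer d (Suc n) * pochhammer e (Suc n) * pochhammer f (Suc n)) *
              exp ((d + e + f - a - b - c) * of_real (ln (of_nat n))))
         \<longlonglongrightarrow> rGamma a * rGamma b * rGamma c / (rGamma d * rGamma e * rGamma f)"
proof -
  \<comment> \<open>Nothing is assumed about \<open>rd\<close>, \<open>re\<close>,
    \<open>rf\<close>; if one of them vanishes, both sides are quotients by 0, hence 0.\<close>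
  have *: "(ra * F * Ea) * (rb * F * Eb) * (rc * F * Ec) / ((rd * F * Ed) * (re * F * Ee) * (rf * F * Ef))
       * (Ed * Ee * Ef / (Ea * Eb * Ec)) = ra * rb * rc / (rd * re * rf)"
    if "F \<noteq> 0" "Ea \<noteq> 0" "Eb \<noteq> 0" "Ec \<noteq> 0" "Ed \<noteq> 0" "Ee \<noteq> 0" "Ef \<noteq> 0"
    for ra rb rc rd re rf F Ea Eb Ec Ed Ee Ef :: complex
  proof (cases "rd * re * rf = 0")
    case False
    then show ?thesis using that by (simp add: field_simps)
  qed auto
  have poch: "pochhammer z (Suc n) = rGamma_series z n * fact n * exp (z * of_real (ln (of_nat n)))"
    for z :: complex and n by (simp add: rGamma_series_def)
  have "(\<lambda>n. rGamma_series a n * rGamma_series b n * rGamma_series c n /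
             (rGamma_series d n * rGamma_series e n * rGamma_series f n))
        \<longlonglongrightarrow> rGamma a * rGamma b * rGamma c / (rGamma d * rGamma e * rGamma f)"
    using assms by (intro tendsto_intros) (auto simp: rGamma_eq_zero_iff)
  then show ?thesis
    unfolding poch left_diff_distrib distrib_right exp_diff exp_add
    by (simp only: * exp_not_eq_zero fact_nonzero not_False_eq_True divide_divide_eq_left)
qed

lemma exp_neg_ln_tendsto_0:
  assumes "Re s > 0"
  shows "(\<lambda>n. exp (- s * of_real (ln (of_nat n)))) \<longlonglongrightarrow> 0"
proof (rule tendsto_norm_zero_cancel)
  have "(\<lambda>n. real n powr (- Re s)) \<longlonglongrightarrow> 0"
    using assms by (intro tendsto_neg_powr filterlim_real_sequentially) auto
  moreover have "\<forall>\<^sub>F n in sequentially. norm (exp (- s * of_real (ln (real n)))) = real n powr (- Re s)"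
    using eventually_gt_at_top[of 0] by eventually_elim (simp add: powr_def)
  ultimately show "(\<lambda>n. norm (exp (- s * of_real (ln (of_nat n))))) \<longlonglongrightarrow> 0"
    by (simp add: tendsto_cong)
qed

lemma pochhammer_quotient_tendsto:
  fixes a b c d e f :: complex
  assumes "d \<notin> \<int>\<^sub>\<le>\<^sub>0" "e \<notin> \<int>\<^sub>\<le>\<^sub>0" "f \<notin> \<int>\<^sub>\<le>\<^sub>0" "a + b + c = d + e + f"
  shows "(\<lambda>n. pochhammer a n * pochhammer b n * pochhammer c n /
              (pochhammer d n * pochhammer e n * pochhammer f n))
         \<longlonglongrightarrow> rGamma a * rGamma b * rGamma c / (rGamma d * rGamma e * rGamma f)"
proof -
  have "d + e + f - a - b - c = 0" using assms(4) by (simp add: algebra_simps)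
  then show ?thesis
    using pochhammer_quotient_times_exp_tendsto[OF assms(1-3), of a b c]
    by (subst filterlim_sequentially_Suc[symmetric]) simp
qed

text \<open>Up to a shift of the index, the quotient is a convergent sequence times \<open>n\<close>
  to the power \<open>- s\<close>, where \<open>s = d + e + f - a - b - c\<close> has positive real
  part.\<close>

lemma pochhammer_quotient_tendsto_0:
  fixes a b c d e f :: complex
  assumes "d \<notin> \<int>\<^sub>\<le>\<^sub>0" "e \<notin> \<int>\<^sub>\<le>\<^sub>0" "f \<notin> \<int>\<^sub>\<le>\<^sub>0" "Re (d + e + f - a - b - c) > 0"
  shows "(\<lambda>n. pochhammer a n * pochhammer b n * pochhammer c n /
              (pochhammer d n * pochhammer e n * pochhammer f n)) \<longlonglongrightarrow> 0"
proof -
  define s where "s = d + e + f - a - b - c"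
  have *: "x * exp (s * l) * exp (- s * l) = x" for x l :: complex
    by (simp add: exp_minus)
  show ?thesis
    using tendsto_mult[OF pochhammer_quotient_times_exp_tendsto[OF assms(1-3), of a b c]
        exp_neg_ln_tendsto_0[of s]] assms(4)
    unfolding s_def[symmetric] * by (subst filterlim_sequentially_Suc[symmetric]) simp
qed

section \<open>Gauss's series at argument 1\<close>

definition hyp2F1_term :: "complex \<Rightarrow> complex \<Rightarrow> complex \<Rightarrow> nat \<Rightarrow> complex" where
  "hyp2F1_term a b c k = pochhammer a k * pochhammer b k / (pochhammer c k * fact k)"

lemma hyp2F1_term_0 [simp]: "hyp2F1_term a b c 0 = 1"
  by (simp add: hyp2F1_term_def)

lemma one_not_nonpos: "(1::complex) \<notin> \<int>\<^sub>\<le>\<^sub>0"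
  by (rule not_nonpos_Ints_if_Re_pos) simp

text \<open>After padding with \<open>pochhammer 1\<close> above and below (\<open>k!\<close> is
  \<open>pochhammer 1 k\<close>), Euler's product bounds the terms by a constant times the modulus
  of \<open>n\<close> to the power \<open>- s\<close> with \<open>s = c + 1 - a - b\<close>; the
  hypothesis says \<open>Re s > 1\<close>.\<close>

lemma summable_hyp2F1_term:
  assumes "c \<notin> \<int>\<^sub>\<le>\<^sub>0" "Re (c - a - b) > 0"
  shows "summable (hyp2F1_term a b c)"
proof -
  define s where "s = c + 1 + 1 - a - b - 1"
  define g where "g n = hyp2F1_term a b c (Suc n) * exp (s * of_real (ln (of_nat n)))" for n
  have "g n = pochhammer a (Suc n) * pochhammer b (Suc n) * pochhammer 1 (Suc n) /
              (pochhammer c (Suc n) * pochhammer 1 (Suc n) * pochhammer 1 (Suc n)) *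
              exp ((c + 1 + 1 - a - b - 1) * of_real (ln (of_nat n)))" for n
    unfolding g_def hyp2F1_term_def s_def[symmetric] pochhammer_fact[symmetric] by simp
  then have "g = (\<lambda>n. pochhammer a (Suc n) * pochhammer b (Suc n) * pochhammer 1 (Suc n) /
              (pochhammer c (Suc n) * pochhammer 1 (Suc n) * pochhammer 1 (Suc n)) *
              exp ((c + 1 + 1 - a - b - 1) * of_real (ln (of_nat n))))" by (intro ext)
  then have "convergent g"
    using convergentI[OF pochhammer_quotient_times_exp_tendsto[OF assms(1) one_not_nonpos one_not_nonpos, of a b 1]]
    by (simp only:)
  then obtain C where C: "\<And>n. norm (g n) \<le> C"
    by (meson convergent_imp_Bseq BseqE)
  have "norm (hyp2F1_term a b c (Suc n)) \<le> C * norm (exp (of_real (ln (of_nat n)) * (- s)))" for n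
  proof -
    have "hyp2F1_term a b c (Suc n) = g n * exp (of_real (ln (of_nat n)) * (- s))"
      unfolding g_def by (simp add: exp_minus field_simps)
    then show ?thesis using C[of n] by (simp add: norm_mult mult_right_mono)
  qed
  moreover have "Re (- s) < -1" using assms(2) by (simp add: s_def)
  then have "summable (\<lambda>n. C * norm (exp (of_real (ln (of_nat n)) * (- s))))"
    by (intro summable_mult) (simp only: abs_summable_complex_powr_iff)
  ultimately have "summable (\<lambda>n. hyp2F1_term a b c (Suc n))"
    by (rule summable_comparison_test'[rotated])
  then show ?thesis by (simp only: summable_Suc_iff)
qed

text \<open>Gauss's contiguous relation between \<open>c\<close> and \<open>c + 1\<close>, kept at
  the level of partial sums: the terms satisfy it up to a difference of consecutive values of
  \<open>c k\<close> times the \<open>k\<close>-th term, so only a boundary term at \<open>n\<close>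
  remains.\<close>

lemma hyp2F1_contiguous_partial_sum:
  assumes "c \<notin> \<int>\<^sub>\<le>\<^sub>0"
  shows "c * (c - a - b) * (\<Sum>k<n. hyp2F1_term a b c k) =
         (c - a) * (c - b) * (\<Sum>k<n. hyp2F1_term a b (c + 1) k) - c * of_nat n * hyp2F1_term a b c n"
proof (induction n)
  case (Suc n)
  define t where "t = hyp2F1_term a b c n"
  have nz: "c \<noteq> 0" "c + of_nat n \<noteq> 0" "pochhammer c n \<noteq> 0"
    using assms not_nonpos_Ints_add_of_nat pochhammer_nonzero by auto
  have nzn: "1 + complex_of_nat n \<noteq> 0" using of_nat_neq_0[of n] by (metis of_nat_Suc)
  have nz': "pochhammer (c + 1) n = pochhammer c n * (c + of_nat n) / c"
    using pochhammer_rec[of c n] nz by (simp add: pochhammer_Suc field_simps)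
  have 1: "hyp2F1_term a b (c + 1) n = t * c / (c + of_nat n)"
    unfolding t_def hyp2F1_term_def nz' using nz by (simp add: field_simps)
  have 2: "of_nat (Suc n) * hyp2F1_term a b c (Suc n) = t * (a + of_nat n) * (b + of_nat n) / (c + of_nat n)"
    unfolding t_def hyp2F1_term_def pochhammer_Suc fact_Suc of_nat_Suc using nz nzn
    by (simp add: divide_simps del: of_nat_Suc)
  have 3: "c * (c - a - b) * t = (c - a) * (c - b) * (t * c / (c + of_nat n)) + c * of_nat n * t
     - c * (t * (a + of_nat n) * (b + of_nat n) / (c + of_nat n))"
    using nz(2) by (simp add: divide_simps) algebra
  have "c * (c - a - b) * (\<Sum>k<Suc n. hyp2F1_term a b c k) =
     c * (c - a - b) * (\<Sum>k<n. hyp2F1_term a b c k) + c * (c - a - b) * t"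
    by (simp add: t_def algebra_simps)
  also have "\<dots> = (c - a) * (c - b) * (\<Sum>k<Suc n. hyp2F1_term a b (c + 1) k)
      - c * (of_nat (Suc n) * hyp2F1_term a b c (Suc n))"
    unfolding Suc.IH 3 2 sum.lessThan_Suc 1 by (simp add: algebra_simps t_def)
  finally show ?case by (simp only: mult.assoc)
qed simp

text \<open>The boundary term vanishes in the limit: up to the factor \<open>a b / c\<close> it is a
  Pochhammer quotient whose lower parameters exceed the upper ones by \<open>c - a - b\<close> in
  total.\<close>

lemma hyp2F1_contiguous:
  assumes "c \<notin> \<int>\<^sub>\<le>\<^sub>0" "Re (c - a - b) > 0"
  shows "suminf (hyp2F1_term a b c) =
         (c - a) * (c - b) / (c * (c - a - b)) * suminf (hyp2F1_term a b (c + 1))"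
proof -
  have nz: "c \<noteq> 0" "c - a - b \<noteq> 0" using assms by auto
  have c1: "c + 1 \<notin> \<int>\<^sub>\<le>\<^sub>0" using assms(1) by (rule not_nonpos_Ints_add_of_nat)
  have eq: "of_nat (Suc n) * hyp2F1_term a b c (Suc n) = a * b / c *
     (pochhammer (a + 1) n * pochhammer (b + 1) n * pochhammer 1 n /
       (pochhammer (c + 1) n * pochhammer 1 n * pochhammer 1 n))" for n
    unfolding hyp2F1_term_def pochhammer_rec fact_Suc pochhammer_fact[symmetric]
    using nz(1) pochhammer_nonzero[OF c1]
    by (simp add: divide_simps del: of_nat_Suc)
  have "(\<lambda>n. of_nat (Suc n) * hyp2F1_term a b c (Suc n)) \<longlonglongrightarrow> a * b / c * 0"
    unfolding eq using assms(2) c1 by (intro tendsto_mult_left pochhammer_quotient_tendsto_0) auto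
  then have "(\<lambda>n. of_nat n * hyp2F1_term a b c n) \<longlonglongrightarrow> 0"
    by (subst filterlim_sequentially_Suc[symmetric]) simp
  then have lim: "(\<lambda>n. (c - a) * (c - b) * (\<Sum>k<n. hyp2F1_term a b (c + 1) k) - c * (of_nat n * hyp2F1_term a b c n))
     \<longlonglongrightarrow> (c - a) * (c - b) * suminf (hyp2F1_term a b (c + 1)) - c * 0"
    using assms(2) by (intro tendsto_intros summable_LIMSEQ summable_hyp2F1_term c1) auto
  have "(\<lambda>n. c * (c - a - b) * (\<Sum>k<n. hyp2F1_term a b c k))
      \<longlonglongrightarrow> c * (c - a - b) * suminf (hyp2F1_term a b c)"
    using assms by (intro tendsto_intros summable_LIMSEQ summable_hyp2F1_term) auto
  with lim have "c * (c - a - b) * suminf (hyp2F1_term a b c)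
      = (c - a) * (c - b) * suminf (hyp2F1_term a b (c + 1))"
    unfolding hyp2F1_contiguous_partial_sum[OF assms(1)] mult.assoc[of c "of_nat _"]
    using LIMSEQ_unique by fastforce
  moreover have "c * (c - a - b) \<noteq> 0" using nz by simp
  ultimately show ?thesis
    by (simp add: nonzero_eq_divide_eq mult.commute del: mult_eq_0_iff)
qed

lemma hyp2F1_shift:
  assumes "c \<notin> \<int>\<^sub>\<le>\<^sub>0" "Re (c - a - b) > 0"
  shows "suminf (hyp2F1_term a b c) =
         pochhammer (c - a) n * pochhammer (c - b) n / (pochhammer c n * pochhammer (c - a - b) n) *
         suminf (hyp2F1_term a b (c + of_nat n))"
proof (induction n)
  case (Suc n)
  have "c + of_nat n \<notin> \<int>\<^sub>\<le>\<^sub>0" "Re (c + of_nat n - a - b) > 0"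
    using assms not_nonpos_Ints_add_of_nat by auto
  from hyp2F1_contiguous[OF this] have *: "suminf (hyp2F1_term a b (c + of_nat n)) =
      (c - a + of_nat n) * (c - b + of_nat n) / ((c + of_nat n) * (c - a - b + of_nat n))
      * suminf (hyp2F1_term a b (c + of_nat (Suc n)))"
    by (simp add: algebra_simps)
  show ?case unfolding Suc.IH * pochhammer_Suc by (simp only: times_divide_eq_left times_divide_eq_right divide_divide_eq_left mult_ac)
qed simp

lemma pochhammer_nonneg_real: "0 \<le> x \<Longrightarrow> 0 \<le> pochhammer (x::real) n"
  unfolding pochhammer_prod by (intro prod_nonneg) auto

lemma norm_pochhammer_le: "norm (pochhammer (z :: complex) n) \<le> pochhammer (norm z) n"
proof (induction n)
  case (Suc n)
  have "norm (z + of_nat n) \<le> norm z + of_nat n"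
    using norm_triangle_ineq[of z "of_nat n"] by simp
  then show ?case unfolding pochhammer_Suc norm_mult
    using Suc by (intro mult_mono) (auto intro: pochhammer_nonneg_real)
qed simp

lemma norm_pochhammer_ge: "Re z \<ge> 0 \<Longrightarrow> norm (pochhammer z n) \<ge> pochhammer (Re z) n"
proof (induction n)
  case (Suc n)
  have "norm (z + of_nat n) \<ge> Re z + of_nat n"
    using complex_Re_le_cmod[of "z + of_nat n"] by simp
  then show ?case unfolding pochhammer_Suc norm_mult
    using Suc by (intro mult_mono) auto
qed simp

lemma pochhammer_mono_real: "0 \<le> x \<Longrightarrow> x \<le> y \<Longrightarrow> pochhammer (x::real) n \<le> pochhammer y n"
  unfolding pochhammer_prod by (intro prod_mono) auto

text \<open>Dominated convergence made explicit: the terms after the leading 1 are bounded by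
  \<open>r / (Re c + n)\<close> times a fixed convergent series as soon as \<open>Re c + n\<close>
  is at least \<open>r\<close>.\<close>

lemma hyp2F1_shift_tendsto_1:
  "(\<lambda>n. suminf (hyp2F1_term a b (c + of_nat n))) \<longlonglongrightarrow> 1"
proof -
  \<comment> \<open>With this \<open>r\<close> the majorant is itself a Gauss series with
    \<open>r - \<alpha> - \<beta> = 1\<close>, so it converges.\<close>
  define \<alpha> \<beta> r where "\<alpha> = norm a" and "\<beta> = norm b" and "r = \<alpha> + \<beta> + 1"
  have r: "r > 0" "\<alpha> \<ge> 0" "\<beta> \<ge> 0" by (auto simp: r_def \<alpha>_def \<beta>_def add_nonneg_pos)
  define h where "h k = pochhammer \<alpha> k * pochhammer \<beta> k / (pochhammer r k * fact k)" for k
  have h: "h k \<ge> 0" for k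
    using r unfolding h_def by (intro divide_nonneg_nonneg mult_nonneg_nonneg pochhammer_nonneg_real) auto
  have "complex_of_real (h k) = hyp2F1_term (of_real \<alpha>) (of_real \<beta>) (of_real r) k" for k
    by (simp add: h_def hyp2F1_term_def pochhammer_of_real)
  moreover have "summable (hyp2F1_term (of_real \<alpha>) (of_real \<beta>) (of_real r))"
    using r by (intro summable_hyp2F1_term not_nonpos_Ints_if_Re_pos) (auto simp: r_def)
  ultimately have "summable (\<lambda>k. complex_of_real (h k))" by simp
  then have sh: "summable h" by (simp only: summable_complex_of_real)
  then have shS: "summable (\<lambda>k. h (Suc k))" by (simp only: summable_Suc_iff)
  have bound: "norm (suminf (hyp2F1_term a b (c + of_nat n)) - 1)
      \<le> r / (Re c + of_nat n) * (\<Sum>k. h (Suc k))" if n: "Re c + of_nat n \<ge> r" for n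
  proof -
    define r' where "r' = Re c + of_nat n"
    have r': "r' \<ge> r" "r' > 0" using n r by (auto simp: r'_def)
    let ?f = "hyp2F1_term a b (c + of_nat n)"
    have le: "norm (?f (Suc k)) \<le> r / r' * h (Suc k)" for k
    proof -
      have "norm (?f (Suc k)) = norm (pochhammer a (Suc k)) * norm (pochhammer b (Suc k)) /
              (norm (pochhammer (c + of_nat n) (Suc k)) * fact (Suc k))"
        unfolding hyp2F1_term_def by (simp only: norm_mult norm_divide norm_fact)
      also have "\<dots> \<le> pochhammer \<alpha> (Suc k) * pochhammer \<beta> (Suc k) /
              (pochhammer r' (Suc k) * fact (Suc k))"
        using r r' norm_pochhammer_ge[of "c + of_nat n" "Suc k"] unfolding \<alpha>_def \<beta>_def
        by (intro frac_le mult_mono mult_nonneg_nonneg mult_pos_pos norm_pochhammer_le pochhammer_nonneg_real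
            pochhammer_pos) (auto simp: r'_def)
      \<comment> \<open>One factor \<open>r'\<close> is split off before \<open>r' \<ge> r\<close>
        is used on the others; it supplies the decay in \<open>n\<close>.\<close>
      also have "\<dots> \<le> pochhammer \<alpha> (Suc k) * pochhammer \<beta> (Suc k) /
              (r' * pochhammer (r + 1) k * fact (Suc k))"
        unfolding pochhammer_rec[of r'] using r r'
        by (intro frac_le mult_mono mult_nonneg_nonneg mult_pos_pos pochhammer_nonneg_real
            pochhammer_pos pochhammer_mono_real) auto
      also have "\<dots> = r / r' * h (Suc k)"
        unfolding h_def pochhammer_rec[of r] using r by simp
      finally show ?thesis .
    qed
    have sn: "summable (\<lambda>k. norm (?f (Suc k)))"
      by (rule summable_comparison_test'[OF summable_mult[OF shS, of "r / r'"], where N = 0])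
        (use le in auto)
    from summable_norm_cancel[OF this] have "summable ?f" by (simp only: summable_Suc_iff)
    then have "suminf ?f - 1 = (\<Sum>k. ?f (Suc k))" by (simp add: suminf_split_head)
    also have "norm \<dots> \<le> (\<Sum>k. norm (?f (Suc k)))" by (rule summable_norm[OF sn])
    also have "\<dots> \<le> (\<Sum>k. r / r' * h (Suc k))"
      by (intro suminf_le le sn summable_mult shS)
    finally show ?thesis by (simp only: suminf_mult[OF shS] r'_def)
  qed
  have lim: "filterlim (\<lambda>n. Re c + of_nat n) at_top sequentially"
    by (intro filterlim_tendsto_add_at_top[OF tendsto_const] filterlim_real_sequentially)
  then have ev: "\<forall>\<^sub>F n in sequentially. Re c + of_nat n \<ge> r"
    by (simp only: filterlim_at_top)
  have "(\<lambda>n. r / (Re c + of_nat n) * (\<Sum>k. h (Suc k))) \<longlonglongrightarrow> 0 * (\<Sum>k. h (Suc k))"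
    by (intro tendsto_mult_right tendsto_divide_0[OF tendsto_const] filterlim_at_top_imp_at_infinity lim)
  then have "(\<lambda>n. r / (Re c + of_nat n) * (\<Sum>k. h (Suc k))) \<longlonglongrightarrow> 0" by (simp only: mult_zero_left)
  then have "(\<lambda>n. suminf (hyp2F1_term a b (c + of_nat n)) - 1) \<longlonglongrightarrow> 0"
    by (rule Lim_null_comparison[rotated]) (rule eventually_mono[OF ev], rule bound)
  then show ?thesis by (simp only: LIM_zero_iff)
qed

text \<open>Pushing \<open>c\<close> to infinity by integer steps: the sum at \<open>c + n\<close>
  tends to 1, while the accumulated factors converge by Euler's product because
  \<open>(c - a) + (c - b) = c + (c - a - b)\<close>.\<close>

theorem gauss_sum:
  assumes "c \<notin> \<int>\<^sub>\<le>\<^sub>0" "Re (c - a - b) > 0"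
  shows "hyp2F1_term a b c sums (rGamma (c - a) * rGamma (c - b) / (rGamma c * rGamma (c - a - b)))"
proof -
  have "(\<lambda>n. pochhammer (c - a) n * pochhammer (c - b) n * pochhammer 1 n /
          (pochhammer c n * pochhammer (c - a - b) n * pochhammer 1 n)
          * suminf (hyp2F1_term a b (c + of_nat n)))
      \<longlonglongrightarrow> rGamma (c - a) * rGamma (c - b) * rGamma 1 / (rGamma c * rGamma (c - a - b) * rGamma 1) * 1"
    using assms not_nonpos_Ints_if_Re_pos[OF assms(2)]
    by (intro tendsto_mult pochhammer_quotient_tendsto hyp2F1_shift_tendsto_1) auto
  moreover have "pochhammer (1::complex) n \<noteq> 0" for n by (simp add: pochhammer_fact[symmetric])
  then have "pochhammer (c - a) n * pochhammer (c - b) n * pochhammer 1 n /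
          (pochhammer c n * pochhammer (c - a - b) n * pochhammer 1 n)
          * suminf (hyp2F1_term a b (c + of_nat n)) = suminf (hyp2F1_term a b c)" for n
    using hyp2F1_shift[OF assms, of n] by simp
  ultimately have "(\<lambda>n. suminf (hyp2F1_term a b c)) \<longlonglongrightarrow>
      rGamma (c - a) * rGamma (c - b) / (rGamma c * rGamma (c - a - b))"
    by simp
  then have "suminf (hyp2F1_term a b c) = rGamma (c - a) * rGamma (c - b) / (rGamma c * rGamma (c - a - b))"
    using LIMSEQ_unique[OF tendsto_const] by blast
  then show ?thesis using summable_hyp2F1_term[OF assms] by (simp add: sums_iff)
qed


section \<open>The three identities\<close>

text \<open>Since \<open>rGamma\<close> vanishes exactly at the poles of \<open>Gamma\<close>, the
  convention for denominator poles is automatic; at a numerator pole both sides are 0 by the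
  conventions for \<open>Gamma\<close> and for division.\<close>

lemma gamma_quotient_eq_rGamma:
  "gamma_quotient ps qs = prod_list (map rGamma qs) / prod_list (map rGamma ps)"
proof -
  have inv: "prod_list (map Gamma xs) = inverse (prod_list (map rGamma xs))" for xs :: "complex list"
    by (induction xs) (auto simp: Gamma_def)
  show ?thesis
  proof (cases "\<exists>q \<in> set qs. q \<in> \<int>\<^sub>\<le>\<^sub>0")
    case True
    then have "prod_list (map rGamma qs) = 0"
      by (auto simp: prod_list_zero_iff rGamma_eq_zero_iff image_iff)
    then show ?thesis using True by (simp add: gamma_quotient_def)
  next
    case False
    then show ?thesis by (simp add: gamma_quotient_def inv field_simps)
  qed
qed

lemma sum_hyp3F2_i:
  fixes a b c d e :: complex
  assumes d: "d \<notin> \<int>\<^sub>\<le>\<^sub>0" and e: "e \<notin> \<int>\<^sub>\<le>\<^sub>0"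
    and quad: "a * b + b * c + c * a = (d - 1) * (e - 1)" and lin: "d + e - a - b - c = 2"
  shows "(\<Sum>k\<le>n. hyp3F2_term a b c d e k) =
     pochhammer (a + 1) n * pochhammer (b + 1) n * pochhammer (c + 1) n /
     (pochhammer d n * pochhammer e n * pochhammer 1 n)"
proof (induction n)
  case (Suc n)
  \<comment> \<open>Every quantity in the induction step is a polynomial in \<open>n\<close> times
    \<open>K\<close>, so the step becomes a polynomial identity. The proofs of (ii) and (iii) follow
    the same pattern.\<close>
  define K where "K = pochhammer (a + 1) n * pochhammer (b + 1) n * pochhammer (c + 1) n /
     (pochhammer d (Suc n) * pochhammer e (Suc n) * pochhammer 1 (Suc n))"
  have nz: "d + of_nat n \<noteq> 0" "e + of_nat n \<noteq> 0" "1 + complex_of_nat n \<noteq> 0"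
    using not_nonpos_Ints_add_of_nat(2)[OF d] not_nonpos_Ints_add_of_nat(2)[OF e]
      not_nonpos_Ints_add_of_nat(2)[OF one_not_nonpos] by auto
  have t: "hyp3F2_term a b c d e (Suc n) = a * b * c * K"
    unfolding hyp3F2_term_def K_def pochhammer_fact pochhammer_rec[of a] pochhammer_rec[of b]
      pochhammer_rec[of c] by (simp only: times_divide_eq_right times_divide_eq_left mult_ac)
  have T0: "pochhammer (a + 1) n * pochhammer (b + 1) n * pochhammer (c + 1) n /
     (pochhammer d n * pochhammer e n * pochhammer 1 n) =
     (d + of_nat n) * (e + of_nat n) * (1 + of_nat n) * K"
    unfolding K_def pochhammer_Suc using nz by (simp add: mult.assoc)
  have T1: "pochhammer (a + 1) (Suc n) * pochhammer (b + 1) (Suc n) * pochhammer (c + 1) (Suc n) /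
     (pochhammer d (Suc n) * pochhammer e (Suc n) * pochhammer 1 (Suc n)) =
     (a + 1 + of_nat n) * (b + 1 + of_nat n) * (c + 1 + of_nat n) * K"
    unfolding K_def pochhammer_Suc[of "a + 1"] pochhammer_Suc[of "b + 1"] pochhammer_Suc[of "c + 1"]
    by (simp only: times_divide_eq_right times_divide_eq_left mult_ac)
  \<comment> \<open>In terms of \<open>M = N + 1\<close> the difference of the two sides is
    \<open>M\<close> times a linear polynomial in \<open>M\<close> whose coefficients are the
    defects of the two constraints.\<close>
  have "(d + N) * (e + N) * (1 + N) + a * b * c = (a + 1 + N) * (b + 1 + N) * (c + 1 + N)"
    for N :: complex
    using quad lin by algebra
  from this[of "of_nat n"] show ?case
    unfolding sum.atMost_Suc Suc.IH T0 T1 t by (metis distrib_right)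
qed (simp add: hyp3F2_term_def)

lemma hyp3F2_i:
  fixes a b c d e :: complex
  assumes d: "d \<notin> \<int>\<^sub>\<le>\<^sub>0" and e: "e \<notin> \<int>\<^sub>\<le>\<^sub>0"
    and quad: "a * b + b * c + c * a = (d - 1) * (e - 1)" and lin: "d + e - a - b - c = 2"
  shows "hyp3F2_term a b c d e sums gamma_quotient [d, e] [a + 1, b + 1, c + 1]"
proof -
  have "(a + 1) + (b + 1) + (c + 1) = d + e + 1" using lin by (simp add: algebra_simps)
  from pochhammer_quotient_tendsto[OF d e one_not_nonpos this] show ?thesis
    unfolding sums_def_le sum_hyp3F2_i[OF assms] gamma_quotient_eq_rGamma by (simp add: mult.assoc)
qed

lemma sum_hyp3F2_ii:
  fixes a b c e :: complex
  assumes c: "c + 2 \<notin> \<int>\<^sub>\<le>\<^sub>0" and e: "e \<notin> \<int>\<^sub>\<le>\<^sub>0"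
    and quad: "(a - 1) * (b - 1) = ((a - 1) + (b - 1) - (e - 1)) * c"
  shows "(\<Sum>k\<le>n. hyp3F2_term a b c (c + 2) e k) =
     (c + 1) * (\<Sum>k\<le>n. hyp2F1_term (a - 1) (b - 1) e k) -
     c * (pochhammer a n * pochhammer b n * pochhammer (c + 1) n /
       (pochhammer e n * pochhammer 1 n * pochhammer (c + 2) n))"
proof (induction n)
  case (Suc n)
  define K where "K = pochhammer a n * pochhammer b n * pochhammer (c + 1) n /
     (pochhammer e (Suc n) * pochhammer 1 (Suc n) * pochhammer (c + 2) (Suc n))"
  have nz: "c + 2 + of_nat n \<noteq> 0" "e + of_nat n \<noteq> 0" "1 + complex_of_nat n \<noteq> 0"
    "pochhammer (c + 2) n \<noteq> 0"
    using not_nonpos_Ints_add_of_nat(2)[OF c] not_nonpos_Ints_add_of_nat(2)[OF e]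
      not_nonpos_Ints_add_of_nat(2)[OF one_not_nonpos] pochhammer_nonzero[OF c] by auto
  \<comment> \<open>Trades \<open>pochhammer (c + 2)\<close> for \<open>pochhammer (c + 1)\<close>
    without dividing by \<open>c + 1\<close>, which may be zero.\<close>
  have CD: "(c + 1) * pochhammer (c + 2) n = pochhammer (c + 1) n * (c + 1 + of_nat n)"
    using pochhammer_rec[of "c + 1" n] by (simp add: pochhammer_Suc add.assoc)
  have t: "hyp3F2_term a b c (c + 2) e (Suc n) = (a + of_nat n) * (b + of_nat n) * c * K"
    unfolding hyp3F2_term_def K_def pochhammer_fact pochhammer_Suc[of a] pochhammer_Suc[of b]
      pochhammer_rec[of c] by (simp only: times_divide_eq_right times_divide_eq_left mult_ac)
  have g: "(c + 1) * hyp2F1_term (a - 1) (b - 1) e (Suc n)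
      = (a - 1) * (b - 1) * (c + 1 + of_nat n) * (c + 2 + of_nat n) * K"
  proof -
    have "(c + 1) * hyp2F1_term (a - 1) (b - 1) e (Suc n) =
        (a - 1) * (b - 1) * pochhammer a n * pochhammer b n * ((c + 1) * pochhammer (c + 2) n) * (c + 2 + of_nat n)
        / (pochhammer e (Suc n) * pochhammer 1 (Suc n) * pochhammer (c + 2) (Suc n))"
      unfolding hyp2F1_term_def pochhammer_fact pochhammer_rec[of "a - 1"] pochhammer_rec[of "b - 1"]
        pochhammer_Suc[of "c + 2"] using nz(1,4) by simp
    then show ?thesis unfolding CD K_def
      by (simp only: times_divide_eq_right times_divide_eq_left mult_ac)
  qed
  have S0: "pochhammer a n * pochhammer b n * pochhammer (c + 1) n /
       (pochhammer e n * pochhammer 1 n * pochhammer (c + 2) n) =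
     (e + of_nat n) * (1 + of_nat n) * (c + 2 + of_nat n) * K"
    unfolding K_def pochhammer_Suc using nz by (simp add: mult.assoc)
  have S1: "pochhammer a (Suc n) * pochhammer b (Suc n) * pochhammer (c + 1) (Suc n) /
       (pochhammer e (Suc n) * pochhammer 1 (Suc n) * pochhammer (c + 2) (Suc n)) =
     (a + of_nat n) * (b + of_nat n) * (c + 1 + of_nat n) * K"
    unfolding K_def pochhammer_Suc[of a] pochhammer_Suc[of b] pochhammer_Suc[of "c + 1"]
    by (simp only: times_divide_eq_right times_divide_eq_left mult_ac)
  \<comment> \<open>The difference of the two sides is \<open>(N + 1) (N + c + 2)\<close> times the
    defect of the quadratic constraint.\<close>
  have *: "(a + N) * (b + N) * c = (a - 1) * (b - 1) * (c + 1 + N) * (c + 2 + N)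
      - c * ((a + N) * (b + N) * (c + 1 + N)) + c * ((e + N) * (1 + N) * (c + 2 + N))" for N :: complex
    using quad by algebra
  define X Y Z where "X = (a - 1) * (b - 1) * (c + 1 + of_nat n) * (c + 2 + of_nat n)"
    and "Y = (a + of_nat n) * (b + of_nat n) * (c + 1 + of_nat n)"
    and "Z = (e + of_nat n) * (1 + of_nat n) * (c + 2 + of_nat n)"
  have "hyp3F2_term a b c (c + 2) e (Suc n) = (X - c * Y + c * Z) * K"
    unfolding t * X_def Y_def Z_def ..
  moreover have "(c + 1) * (\<Sum>k\<le>Suc n. hyp2F1_term (a - 1) (b - 1) e k) =
      (c + 1) * (\<Sum>k\<le>n. hyp2F1_term (a - 1) (b - 1) e k) + X * K"
    unfolding sum.atMost_Suc distrib_left[of "c + 1"] g[folded X_def] ..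
  ultimately show ?case
    unfolding S1[folded Y_def] sum.atMost_Suc[of "hyp3F2_term a b c (c + 2) e"] Suc.IH S0[folded Z_def]
    by (simp only: left_diff_distrib distrib_right mult.assoc) simp
qed (simp add: hyp3F2_term_def)

lemma hyp3F2_ii:
  fixes a b c e :: complex
  assumes c: "c + 2 \<notin> \<int>\<^sub>\<le>\<^sub>0" and e: "e \<notin> \<int>\<^sub>\<le>\<^sub>0"
    and quad: "(a - 1) * (b - 1) = ((a - 1) + (b - 1) - (e - 1)) * c"
    and pos: "Re (e - a - b + 2) > 0"
  shows "hyp3F2_term a b c (c + 2) e sums
        gamma_quotient [e, e - a - b + 2, c + 2] [e - a + 1, e - b + 1, c + 1]"
proof -
  have eqs: "e - (a - 1) - (b - 1) = e - a - b + 2" "e - (a - 1) = e - a + 1" "e - (b - 1) = e - b + 1"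
    by simp_all
  have "Re (e - (a - 1) - (b - 1)) > 0" unfolding eqs(1) by (rule pos)
  note gauss = gauss_sum[OF e this, unfolded eqs(1), unfolded eqs(2,3)]
  have G: "(\<lambda>n. \<Sum>k\<le>n. hyp2F1_term (a - 1) (b - 1) e k) \<longlonglongrightarrow>
      rGamma (e - a + 1) * rGamma (e - b + 1) / (rGamma e * rGamma (e - a - b + 2))"
    using gauss by (simp only: sums_def_le)
  have S: "(\<lambda>n. pochhammer a n * pochhammer b n * pochhammer (c + 1) n /
       (pochhammer e n * pochhammer 1 n * pochhammer (c + 2) n)) \<longlonglongrightarrow> 0"
    using pos by (intro pochhammer_quotient_tendsto_0 c e one_not_nonpos) simp
  \<comment> \<open>The factor \<open>c + 1\<close> of the partial sums equals
    \<open>rGamma (c + 1) / rGamma (c + 2)\<close>, also at the admissible value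
    \<open>c = -1\<close>, where it is 0.\<close>
  have "c + 1 + 1 = c + 2" by simp
  then have r: "rGamma (c + 1) = (c + 1) * rGamma (c + 2)"
    using rGamma_plus1[of "c + 1"] by (simp only:)
  have "rGamma (c + 2) \<noteq> 0" using c by (simp add: rGamma_eq_zero_iff)
  then have "(c + 1) * (rGamma (e - a + 1) * rGamma (e - b + 1) / (rGamma e * rGamma (e - a - b + 2))) - c * 0
     = gamma_quotient [e, e - a - b + 2, c + 2] [e - a + 1, e - b + 1, c + 1]"
    unfolding gamma_quotient_eq_rGamma by (simp add: r)
  moreover have "(\<lambda>n. \<Sum>k\<le>n. hyp3F2_term a b c (c + 2) e k) \<longlonglongrightarrow>
     (c + 1) * (rGamma (e - a + 1) * rGamma (e - b + 1) / (rGamma e * rGamma (e - a - b + 2))) - c * 0"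
    unfolding sum_hyp3F2_ii[OF c e quad] by (intro tendsto_intros G S)
  ultimately show ?thesis by (simp add: sums_def_le)
qed

text \<open>The upper parameter 2 against \<open>k!\<close> leaves the linear factor
  \<open>k + 1\<close>, which a difference of two monic quadratic polynomials can supply. Padding
  with \<open>pochhammer 1 n\<close> fits the remainder to the limits with three factors above and
  below.\<close>

lemma sum_hyp3F2_iii:
  fixes a b d e :: complex
  assumes d: "d \<notin> \<int>\<^sub>\<le>\<^sub>0" and e: "e \<notin> \<int>\<^sub>\<le>\<^sub>0"
    and quad: "(a - 1) * (b - 1) = (d - 2) * (e - 2)"
  shows "(d + e - a - b - 2) * (\<Sum>k\<le>n. hyp3F2_term a b 2 d e k) =
     (d - 1) * (e - 1) - a * b * (pochhammer (a + 1) n * pochhammer (b + 1) n * pochhammer 1 n /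
        (pochhammer d n * pochhammer e n * pochhammer 1 n))"
proof (induction n)
  case 0
  show ?case using quad by (simp add: hyp3F2_term_def) algebra
next
  case (Suc n)
  define K where "K = a * b * pochhammer (a + 1) n * pochhammer (b + 1) n * pochhammer 1 (Suc n) /
     (pochhammer d (Suc n) * pochhammer e (Suc n) * pochhammer 1 (Suc n))"
  have nz: "d + of_nat n \<noteq> 0" "e + of_nat n \<noteq> 0" "1 + complex_of_nat n \<noteq> 0"
    "pochhammer (1::complex) n \<noteq> 0"
    using not_nonpos_Ints_add_of_nat(2)[OF d] not_nonpos_Ints_add_of_nat(2)[OF e]
      not_nonpos_Ints_add_of_nat(2)[OF one_not_nonpos] pochhammer_nonzero[OF one_not_nonpos]
    by auto
  have two: "pochhammer 2 (Suc n) = pochhammer 1 (Suc n) * (2 + complex_of_nat n)"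
  proof -
    have "pochhammer 2 (Suc n) = pochhammer (1::complex) (Suc (Suc n))"
      using pochhammer_rec[of "1::complex" "Suc n"] by simp
    then show ?thesis by (simp only: pochhammer_Suc[of "1::complex" "Suc n"]) simp
  qed
  have t: "hyp3F2_term a b 2 d e (Suc n) = (2 + of_nat n) * K"
    unfolding hyp3F2_term_def K_def pochhammer_fact pochhammer_rec[of a] pochhammer_rec[of b] two
    by (simp only: times_divide_eq_right times_divide_eq_left mult_ac)
  have S0: "a * b * (pochhammer (a + 1) n * pochhammer (b + 1) n * pochhammer 1 n /
        (pochhammer d n * pochhammer e n * pochhammer 1 n)) = (d + of_nat n) * (e + of_nat n) * K"
    unfolding K_def pochhammer_Suc using nz by (simp add: mult.assoc)
  have S1: "a * b * (pochhammer (a + 1) (Suc n) * pochhammer (b + 1) (Suc n) * pochhammer 1 (Suc n) /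
        (pochhammer d (Suc n) * pochhammer e (Suc n) * pochhammer 1 (Suc n)))
     = (a + 1 + of_nat n) * (b + 1 + of_nat n) * K"
    unfolding K_def pochhammer_Suc[of "a + 1"] pochhammer_Suc[of "b + 1"]
    by (simp only: times_divide_eq_right times_divide_eq_left mult_ac)
  \<comment> \<open>In terms of \<open>M = N + 2\<close> the coefficient of \<open>M\<close> agrees
    on both sides, and the constant term is the quadratic constraint.\<close>
  have *: "(d + e - a - b - 2) * (2 + N) = (d + N) * (e + N) - (a + 1 + N) * (b + 1 + N)" for N :: complex
    using quad by algebra
  have "(d + e - a - b - 2) * hyp3F2_term a b 2 d e (Suc n) =
      (d + of_nat n) * (e + of_nat n) * K - (a + 1 + of_nat n) * (b + 1 + of_nat n) * K"
    unfolding t mult.assoc[symmetric] * by (simp only: left_diff_distrib)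
  then show ?case
    unfolding sum.atMost_Suc distrib_left Suc.IH S0 S1 by simp
qed

lemma hyp3F2_iii:
  fixes a b d e :: complex
  assumes d: "d \<notin> \<int>\<^sub>\<le>\<^sub>0" and e: "e \<notin> \<int>\<^sub>\<le>\<^sub>0"
    and quad: "(a - 1) * (b - 1) = (d - 2) * (e - 2)"
    and pos: "Re (d + e - a - b - 2) > 0"
  shows "hyp3F2_term a b 2 d e sums ((d - 1) * (e - 1) / (d + e - a - b - 2))"
proof -
  have s: "d + e - a - b - 2 \<noteq> 0" using pos by (metis less_irrefl zero_complex.sel(1))
  have "(\<lambda>n. pochhammer (a + 1) n * pochhammer (b + 1) n * pochhammer 1 n /
        (pochhammer d n * pochhammer e n * pochhammer 1 n)) \<longlonglongrightarrow> 0"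
    using pos by (intro pochhammer_quotient_tendsto_0 d e one_not_nonpos) simp
  then have "(\<lambda>n. ((d - 1) * (e - 1) - a * b * (pochhammer (a + 1) n * pochhammer (b + 1) n * pochhammer 1 n /
        (pochhammer d n * pochhammer e n * pochhammer 1 n))) / (d + e - a - b - 2))
      \<longlonglongrightarrow> ((d - 1) * (e - 1) - a * b * 0) / (d + e - a - b - 2)"
    by (intro tendsto_intros s)
  then show ?thesis
    unfolding sum_hyp3F2_iii[OF d e quad, symmetric] sums_def_le using s by simp
qed

text \<open>Each of \<open>d - 1\<close>, \<open>e - 1\<close> and \<open>1 / s\<close> is a
  quotient of gamma values at arguments differing by 1. This gives the rational value in (iii) the
  form that the summation property demands; at \<open>d = 1\<close> or \<open>e = 1\<close> the
  denominator pole matches the value 0.\<close>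

lemma hyp3F2_iii_gamma_quotient:
  assumes "Re s > 0" and that: "d \<notin> \<int>\<^sub>\<le>\<^sub>0" "e \<notin> \<int>\<^sub>\<le>\<^sub>0"
  shows "(d - 1) * (e - 1) / s = gamma_quotient [d, e, s] [d - 1, e - 1, s + 1]"
proof -
  have "rGamma d \<noteq> 0" "rGamma e \<noteq> 0" "rGamma s \<noteq> 0" "s \<noteq> 0"
    using assms not_nonpos_Ints_if_Re_pos[OF assms(1)] by (auto simp: rGamma_eq_zero_iff)
  moreover have "rGamma (d - 1) = (d - 1) * rGamma d" "rGamma (e - 1) = (e - 1) * rGamma e"
    "rGamma s = s * rGamma (s + 1)"
    using rGamma_plus1[of "d - 1"] rGamma_plus1[of "e - 1"] rGamma_plus1[of s] by auto
  ultimately show ?thesis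
    unfolding gamma_quotient_eq_rGamma by simp
qed


section \<open>The gamma quotient summation property\<close>

lemma exhaust_5:
  fixes x :: 5
  shows "x = 1 \<or> x = 2 \<or> x = 3 \<or> x = 4 \<or> x = 5"
proof (induct x)
  case (of_int z)
  then have "z = 0 \<or> z = 1 \<or> z = 2 \<or> z = 3 \<or> z = 4" by fastforce
  then show ?case by auto
qed

lemma forall_5: "(\<forall>i::5. P i) \<longleftrightarrow> P 1 \<and> P 2 \<and> P 3 \<and> P 4 \<and> P 5"
  by (metis exhaust_5)

lemma UNIV_5: "UNIV = {1, 2, 3, 4, 5::5}"
  using exhaust_5 by auto

lemma sum_5: "sum f (UNIV::5 set) = f 1 + f 2 + f 3 + f 4 + f 5"
  unfolding UNIV_5 by (simp add: ac_simps)

lemma vector_5 [simp]: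
  "(vector [a, b, c, d, e] :: ('a::zero)^5) $ 1 = a"
  "(vector [a, b, c, d, e] :: ('a::zero)^5) $ 2 = b"
  "(vector [a, b, c, d, e] :: ('a::zero)^5) $ 3 = c"
  "(vector [a, b, c, d, e] :: ('a::zero)^5) $ 4 = d"
  "(vector [a, b, c, d, e] :: ('a::zero)^5) $ 5 = e"
  unfolding vector_def by simp_all

lemma vec_eq_5: "(x :: 'a^5) = y \<longleftrightarrow> x $ 1 = y $ 1 \<and> x $ 2 = y $ 2 \<and> x $ 3 = y $ 3 \<and> x $ 4 = y $ 4 \<and> x $ 5 = y $ 5"
  by (simp add: vec_eq_iff forall_5)

lemma vector_5_eta: "vector [p $ 1, p $ 2, p $ 3, p $ 4, p $ 5] = (p :: ('a::zero)^5)"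
  by (simp add: vec_eq_5)

lemma variety_i_iff:
  "p \<in> variety_i \<longleftrightarrow> p $ 1 * p $ 2 + p $ 2 * p $ 3 + p $ 3 * p $ 1 = (p $ 4 - 1) * (p $ 5 - 1) \<and>
     p $ 4 + p $ 5 - p $ 1 - p $ 2 - p $ 3 = 2"
  unfolding variety_i_def by (auto simp: vec_eq_5)

lemma variety_ii_iff:
  "p \<in> variety_ii \<longleftrightarrow> p $ 4 = p $ 3 + 2 \<and>
     (p $ 1 - 1) * (p $ 2 - 1) = ((p $ 1 - 1) + (p $ 2 - 1) - (p $ 5 - 1)) * p $ 3"
  unfolding variety_ii_def by (auto simp: vec_eq_5)

lemma variety_iii_iff:
  "p \<in> variety_iii \<longleftrightarrow> p $ 3 = 2 \<and> (p $ 1 - 1) * (p $ 2 - 1) = (p $ 4 - 2) * (p $ 5 - 2)"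
  unfolding variety_iii_def by (auto simp: vec_eq_5)

section \<open>Affine functions with rational coefficients\<close>

lemma rat_affine_const: "(\<lambda>p. of_rat r) \<in> rat_affine_functions"
  unfolding rat_affine_functions_def by (rule CollectI, rule exI[of _ r], rule exI[of _ 0]) simp

lemma rat_affine_coord: "(\<lambda>p. p $ i) \<in> rat_affine_functions"
proof -
  have "of_rat (axis i 1 $ j) * p $ j = (if j = i then p $ j else 0)" for j and p :: "complex^5"
    by (simp add: axis_def)
  then have "(\<lambda>p. p $ i) = (\<lambda>p. of_rat 0 + (\<Sum>j\<in>UNIV. of_rat (axis i 1 $ j) * (p :: complex^5) $ j))"
    by simp
  then show ?thesis unfolding rat_affine_functions_def by blast
qed

lemma rat_affine_add:
  assumes "f \<in> rat_affine_functions" "g \<in> rat_affine_functions"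
  shows "(\<lambda>p. f p + g p) \<in> rat_affine_functions"
proof -
  from assms obtain r m r' m' where f: "f = (\<lambda>p. of_rat r + (\<Sum>i\<in>UNIV. of_rat (m $ i) * p $ i))"
    and g: "g = (\<lambda>p. of_rat r' + (\<Sum>i\<in>UNIV. of_rat (m' $ i) * p $ i))"
    unfolding rat_affine_functions_def by blast
  have "(\<lambda>p. f p + g p) = (\<lambda>p. of_rat (r + r') + (\<Sum>i\<in>UNIV. of_rat ((m + m') $ i) * p $ i))"
    unfolding f g by (simp add: of_rat_add algebra_simps sum.distrib)
  then show ?thesis unfolding rat_affine_functions_def by blast
qed

lemma rat_affine_diff:
  assumes "f \<in> rat_affine_functions" "g \<in> rat_affine_functions"
  shows "(\<lambda>p. f p - g p) \<in> rat_affine_functions"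
proof -
  from assms obtain r m r' m' where f: "f = (\<lambda>p. of_rat r + (\<Sum>i\<in>UNIV. of_rat (m $ i) * p $ i))"
    and g: "g = (\<lambda>p. of_rat r' + (\<Sum>i\<in>UNIV. of_rat (m' $ i) * p $ i))"
    unfolding rat_affine_functions_def by blast
  have "(\<lambda>p. f p - g p) = (\<lambda>p. of_rat (r - r') + (\<Sum>i\<in>UNIV. of_rat ((m - m') $ i) * p $ i))"
    unfolding f g by (simp add: of_rat_diff algebra_simps sum_subtractf)
  then show ?thesis unfolding rat_affine_functions_def by blast
qed

lemmas rat_affine_intros = rat_affine_add rat_affine_diff rat_affine_coord
  rat_affine_const[of 1, simplified] rat_affine_const[of 2, simplified]

lemma gamma_quotient_summation_iff:
  "gamma_quotient_summation V \<longleftrightarrow>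
     (\<exists>P Q. set P \<subseteq> rat_affine_functions \<and> set Q \<subseteq> rat_affine_functions \<and>
       (\<forall>p\<in>V. Re (p $ 4 + p $ 5 - p $ 1 - p $ 2 - p $ 3) > 0 \<longrightarrow> p $ 4 \<notin> \<int>\<^sub>\<le>\<^sub>0 \<longrightarrow> p $ 5 \<notin> \<int>\<^sub>\<le>\<^sub>0 \<longrightarrow>
          gamma_quotient_defined (map (\<lambda>f. f p) P) (map (\<lambda>f. f p) Q) \<and>
          hyp3F2_term (p $ 1) (p $ 2) (p $ 3) (p $ 4) (p $ 5) sums
            gamma_quotient (map (\<lambda>f. f p) P) (map (\<lambda>f. f p) Q)))"
  unfolding gamma_quotient_summation_def Let_def
  apply (intro ex_cong1 conj_cong refl iffI ballI allI impI)
  subgoal for P Q p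
    by (drule spec[of _ "p $ 1"], drule spec[of _ "p $ 2"], drule spec[of _ "p $ 3"],
        drule spec[of _ "p $ 4"], drule spec[of _ "p $ 5"]) (simp only: vector_5_eta simp_thms)
  subgoal for P Q a b c d e
    by (drule bspec[of _ _ "vector [a, b, c, d, e]"], assumption) (simp only: vector_5 simp_thms)
  done

lemma gamma_quotient_summation_variety_i: "gamma_quotient_summation variety_i"
  unfolding gamma_quotient_summation_iff
proof (intro exI conjI ballI impI)
  let ?P = "[\<lambda>p. p $ 4, \<lambda>p. p $ 5] :: (complex^5 \<Rightarrow> complex) list"
  let ?Q = "[\<lambda>p. p $ 1 + 1, \<lambda>p. p $ 2 + 1, \<lambda>p. p $ 3 + 1] :: (complex^5 \<Rightarrow> complex) list"
  show "set ?P \<subseteq> rat_affine_functions" "set ?Q \<subseteq> rat_affine_functions"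
    unfolding list.set insert_subset by (intro conjI rat_affine_intros empty_subsetI)+
  fix p :: "complex^5"
  assume "p \<in> variety_i" "p $ 4 \<notin> \<int>\<^sub>\<le>\<^sub>0" "p $ 5 \<notin> \<int>\<^sub>\<le>\<^sub>0"
  then show "gamma_quotient_defined (map (\<lambda>f. f p) ?P) (map (\<lambda>f. f p) ?Q)"
    "hyp3F2_term (p $ 1) (p $ 2) (p $ 3) (p $ 4) (p $ 5) sums
       gamma_quotient (map (\<lambda>f. f p) ?P) (map (\<lambda>f. f p) ?Q)"
    using hyp3F2_i by (auto simp: gamma_quotient_defined_def variety_i_iff)
qed

lemma gamma_quotient_summation_variety_ii: "gamma_quotient_summation variety_ii"
  unfolding gamma_quotient_summation_iff
proof (intro exI conjI ballI impI)
  let ?P = "[\<lambda>p. p $ 5, \<lambda>p. p $ 5 - p $ 1 - p $ 2 + 2, \<lambda>p. p $ 3 + 2] :: (complex^5 \<Rightarrow> complex) list"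
  let ?Q = "[\<lambda>p. p $ 5 - p $ 1 + 1, \<lambda>p. p $ 5 - p $ 2 + 1, \<lambda>p. p $ 3 + 1] :: (complex^5 \<Rightarrow> complex) list"
  show "set ?P \<subseteq> rat_affine_functions" "set ?Q \<subseteq> rat_affine_functions"
    unfolding list.set insert_subset by (intro conjI rat_affine_intros empty_subsetI)+
  fix p :: "complex^5"
  assume p: "p \<in> variety_ii" "p $ 4 \<notin> \<int>\<^sub>\<le>\<^sub>0" "p $ 5 \<notin> \<int>\<^sub>\<le>\<^sub>0"
    and pos: "Re (p $ 4 + p $ 5 - p $ 1 - p $ 2 - p $ 3) > 0"
  from p have *: "p $ 4 = p $ 3 + 2" "p $ 3 + 2 \<notin> \<int>\<^sub>\<le>\<^sub>0"
    "(p $ 1 - 1) * (p $ 2 - 1) = ((p $ 1 - 1) + (p $ 2 - 1) - (p $ 5 - 1)) * p $ 3"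
    by (auto simp: variety_ii_iff)
  have pos': "Re (p $ 5 - p $ 1 - p $ 2 + 2) > 0" using pos *(1) by simp
  show "gamma_quotient_defined (map (\<lambda>f. f p) ?P) (map (\<lambda>f. f p) ?Q)"
    using not_nonpos_Ints_if_Re_pos[OF pos'] * p(3) by (auto simp: gamma_quotient_defined_def)
  show "hyp3F2_term (p $ 1) (p $ 2) (p $ 3) (p $ 4) (p $ 5) sums
       gamma_quotient (map (\<lambda>f. f p) ?P) (map (\<lambda>f. f p) ?Q)"
    using hyp3F2_ii[OF *(2) p(3) *(3) pos'] by (simp add: *(1))
qed

lemma gamma_quotient_summation_variety_iii: "gamma_quotient_summation variety_iii"
  unfolding gamma_quotient_summation_iff
proof (intro exI conjI ballI impI)
  let ?s = "\<lambda>p :: complex^5. p $ 4 + p $ 5 - p $ 1 - p $ 2 - 2"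
  let ?P = "[\<lambda>p. p $ 4, \<lambda>p. p $ 5, ?s]"
  let ?Q = "[\<lambda>p. p $ 4 - 1, \<lambda>p. p $ 5 - 1, \<lambda>p. ?s p + 1]"
  show "set ?P \<subseteq> rat_affine_functions" "set ?Q \<subseteq> rat_affine_functions"
    unfolding list.set insert_subset by (intro conjI rat_affine_intros empty_subsetI)+
  fix p :: "complex^5"
  assume p: "p \<in> variety_iii" "p $ 4 \<notin> \<int>\<^sub>\<le>\<^sub>0" "p $ 5 \<notin> \<int>\<^sub>\<le>\<^sub>0"
    and pos: "Re (p $ 4 + p $ 5 - p $ 1 - p $ 2 - p $ 3) > 0"
  from p have *: "p $ 3 = 2" "(p $ 1 - 1) * (p $ 2 - 1) = (p $ 4 - 2) * (p $ 5 - 2)"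
    by (auto simp: variety_iii_iff)
  have pos': "Re (?s p) > 0" using pos *(1) by simp
  show "gamma_quotient_defined (map (\<lambda>f. f p) ?P) (map (\<lambda>f. f p) ?Q)"
    using not_nonpos_Ints_if_Re_pos[OF pos'] * p(2,3) by (auto simp: gamma_quotient_defined_def)
  show "hyp3F2_term (p $ 1) (p $ 2) (p $ 3) (p $ 4) (p $ 5) sums
       gamma_quotient (map (\<lambda>f. f p) ?P) (map (\<lambda>f. f p) ?Q)"
    using hyp3F2_iii[OF p(2,3) *(2) pos'] hyp3F2_iii_gamma_quotient[OF pos' p(2,3)] by (simp add: *(1))
qed

lemma rat_affine_permute:
  assumes "f \<in> rat_affine_functions" "bij \<tau>"
  shows "(\<lambda>p. f (\<chi> i. p $ \<tau> i)) \<in> rat_affine_functions"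
proof -
  from assms obtain r m where f: "f = (\<lambda>p. of_rat r + (\<Sum>i\<in>UNIV. of_rat (m $ i) * p $ i))"
    unfolding rat_affine_functions_def by blast
  have "(\<Sum>i\<in>UNIV. of_rat (m $ i) * p $ \<tau> i) = (\<Sum>i\<in>UNIV. of_rat ((\<chi> j. m $ inv \<tau> j) $ i) * p $ i)"
    for p :: "complex^5"
    using sum.reindex_bij_betw[OF assms(2), of "\<lambda>i. of_rat (m $ inv \<tau> i) * p $ i"] assms(2)
    by (simp add: bij_is_inj)
  then have "(\<lambda>p. f (\<chi> i. p $ \<tau> i)) =
      (\<lambda>p. of_rat r + (\<Sum>i\<in>UNIV. of_rat ((\<chi> j. m $ inv \<tau> j) $ i) * p $ i))"
    unfolding f by (simp add: fun_eq_iff)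
  then show ?thesis unfolding rat_affine_functions_def by blast
qed

text \<open>The terms of the series, the convergence condition and the condition on the lower
  parameters are symmetric under \<open>h\<close>, and composing the affine functions with the
  inverse permutation keeps their coefficients rational.\<close>

lemma gamma_quotient_summation_separate_permutation:
  assumes V: "gamma_quotient_summation V" and h: "h \<in> separate_permutations"
  shows "gamma_quotient_summation (h ` V)"
proof -
  from h obtain \<sigma> where h: "h = (\<lambda>p. \<chi> i. p $ \<sigma> i)" and \<sigma>: "\<sigma> permutes UNIV"
    and up: "\<sigma> ` {1, 2, 3} = {1, 2, 3}" and low: "\<sigma> ` {4, 5} = {4, 5}"
    unfolding separate_permutations_def by blast
  have bij: "bij \<sigma>" using \<sigma> by (rule permutes_bij)
  then have inj: "inj_on \<sigma> A" for A by (meson bij_is_inj inj_on_subset subset_UNIV)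
  from V obtain P Q where PQ: "set P \<subseteq> rat_affine_functions" "set Q \<subseteq> rat_affine_functions"
    and S: "\<And>p. \<lbrakk>p\<in>V; Re (p $ 4 + p $ 5 - p $ 1 - p $ 2 - p $ 3) > 0; p $ 4 \<notin> \<int>\<^sub>\<le>\<^sub>0; p $ 5 \<notin> \<int>\<^sub>\<le>\<^sub>0\<rbrakk> \<Longrightarrow>
          gamma_quotient_defined (map (\<lambda>f. f p) P) (map (\<lambda>f. f p) Q) \<and>
          hyp3F2_term (p $ 1) (p $ 2) (p $ 3) (p $ 4) (p $ 5) sums
            gamma_quotient (map (\<lambda>f. f p) P) (map (\<lambda>f. f p) Q)"
    unfolding gamma_quotient_summation_iff by blast
  define h' where "h' = (\<lambda>p :: complex^5. \<chi> i. p $ inv \<sigma> i)"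
  have h'h: "h' (h p) = p" for p
    using bij by (simp add: h h'_def vec_eq_iff bij_is_surj surj_f_inv_f)
  define L where "L = map (\<lambda>f p. f (h' p :: complex^5) :: complex)"
  have L: "map (\<lambda>f. f (h p)) (L R) = map (\<lambda>f. f p) R" for R p
    by (simp add: L_def h'h)
  have "set R \<subseteq> rat_affine_functions \<Longrightarrow> set (L R) \<subseteq> rat_affine_functions" for R
    unfolding L_def h'_def using rat_affine_permute[OF _ bij_imp_bij_inv[OF bij]] by auto
  moreover have "hyp3F2_term (h p $ 1) (h p $ 2) (h p $ 3) (h p $ 4) (h p $ 5) =
      hyp3F2_term (p $ 1) (p $ 2) (p $ 3) (p $ 4) (p $ 5)" for p
  proof
    fix k
    have *: "hyp3F2_term (q $ 1) (q $ 2) (q $ 3) (q $ 4) (q $ 5) k =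
      (\<Prod>i\<in>{1,2,3}. pochhammer (q $ i) k) / ((\<Prod>i\<in>{4,5}. pochhammer (q $ i) k) * fact k)" for q :: "complex^5"
      by (simp add: hyp3F2_term_def mult.assoc)
    have "(\<Prod>i\<in>A. pochhammer (h p $ i) k) = (\<Prod>i\<in>\<sigma> ` A. pochhammer (p $ i) k)" for A
      using inj by (simp add: prod.reindex h)
    then show "hyp3F2_term (h p $ 1) (h p $ 2) (h p $ 3) (h p $ 4) (h p $ 5) k =
      hyp3F2_term (p $ 1) (p $ 2) (p $ 3) (p $ 4) (p $ 5) k"
      unfolding * by (simp only: up low)
  qed
  moreover have "h p $ 4 + h p $ 5 - h p $ 1 - h p $ 2 - h p $ 3 = p $ 4 + p $ 5 - p $ 1 - p $ 2 - p $ 3" for p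
  proof -
    have *: "q $ 4 + q $ 5 - q $ 1 - q $ 2 - q $ 3 = (\<Sum>i\<in>{4,5}. q $ i) - (\<Sum>i\<in>{1,2,3}. q $ i)"
      for q :: "complex^5" by simp
    have "(\<Sum>i\<in>A. h p $ i) = (\<Sum>i\<in>\<sigma> ` A. p $ i)" for A
      using inj by (simp add: sum.reindex h)
    then show ?thesis unfolding * by (simp only: up low)
  qed
  moreover have "p $ 4 \<notin> \<int>\<^sub>\<le>\<^sub>0 \<and> p $ 5 \<notin> \<int>\<^sub>\<le>\<^sub>0" if "h p $ 4 \<notin> \<int>\<^sub>\<le>\<^sub>0" "h p $ 5 \<notin> \<int>\<^sub>\<le>\<^sub>0" for p
  proof -
    have "\<forall>i\<in>\<sigma> ` {4, 5}. p $ i \<notin> \<int>\<^sub>\<le>\<^sub>0" using that by (simp add: h)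
    then show ?thesis unfolding low by simp
  qed
  ultimately show ?thesis
    unfolding gamma_quotient_summation_iff
    using PQ S by - (rule exI[of _ "L P"], rule exI[of _ "L Q"], auto simp: L simp del: minus_complex.sel plus_complex.sel)
qed


section \<open>Irreducibility and dimension of the quadric cone\<close>

lemma polynomial_functions_diff:
  assumes "f \<in> polynomial_functions" "g \<in> polynomial_functions"
  shows "(\<lambda>p. f p - g p) \<in> polynomial_functions"
  using polynomial_functions.add[OF assms(1) polynomial_functions.mult[OF polynomial_functions.const[of "-1"] assms(2)]]
  by simp

lemma polynomial_functions_sum:
  assumes "\<And>i. i \<in> A \<Longrightarrow> f i \<in> polynomial_functions"
  shows "(\<lambda>p. \<Sum>i\<in>A. f i p) \<in> polynomial_functions"
  using assms
  by (induction A rule: infinite_finite_induct) (auto intro: polynomial_functions.intros)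

lemma polynomial_functions_power:
  assumes "f \<in> polynomial_functions"
  shows "(\<lambda>p. f p ^ n) \<in> polynomial_functions"
  using assms by (induction n) (auto intro: polynomial_functions.intros)

definition polynomial_map :: "(complex^'m \<Rightarrow> complex^'n) \<Rightarrow> bool" where
  "polynomial_map M \<longleftrightarrow> (\<forall>i. (\<lambda>q. M q $ i) \<in> polynomial_functions)"

lemma polynomial_functions_compose:
  assumes "f \<in> polynomial_functions" "polynomial_map M"
  shows "(\<lambda>q. f (M q)) \<in> polynomial_functions"
  using assms(1)
proof induction
  case (coord i)
  then show ?case using assms(2) by (simp add: polynomial_map_def)
qed (auto intro: polynomial_functions.intros)

lemma zariski_closed_vimage:
  assumes "zariski_closed V" "polynomial_map M"
  shows "zariski_closed (M -` V)"
proof -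
  from assms(1) obtain F where F: "F \<subseteq> polynomial_functions" "V = {p. \<forall>f\<in>F. f p = 0}"
    unfolding zariski_closed_def by blast
  have "(\<lambda>f q. f (M q)) ` F \<subseteq> polynomial_functions"
    using F(1) polynomial_functions_compose[OF _ assms(2)] by auto
  moreover have "M -` V = {q. \<forall>f\<in>(\<lambda>f q. f (M q)) ` F. f q = 0}"
    unfolding F(2) by auto
  ultimately show ?thesis unfolding zariski_closed_def by blast
qed

lemma polynomial_function_on_curve:
  assumes "f \<in> polynomial_functions"
  shows "\<exists>g. \<forall>t. f (\<chi> i. poly (\<gamma> i) t) = poly g t"
  using assms
proof induction
  case (const c)
  show ?case by (rule exI[of _ "[:c:]"]) simp
next
  case (coord i)
  show ?case by (rule exI[of _ "\<gamma> i"]) simp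
next
  case (add f g)
  then obtain p q where "\<forall>t. f (\<chi> i. poly (\<gamma> i) t) = poly p t" "\<forall>t. g (\<chi> i. poly (\<gamma> i) t) = poly q t"
    by blast
  then show ?case by (intro exI[of _ "p + q"]) simp
next
  case (mult f g)
  then obtain p q where "\<forall>t. f (\<chi> i. poly (\<gamma> i) t) = poly p t" "\<forall>t. g (\<chi> i. poly (\<gamma> i) t) = poly q t"
    by blast
  then show ?case by (intro exI[of _ "p * q"]) simp
qed

text \<open>The coordinate ring of an irreducible set has no zero divisors: the zero sets of
  \<open>f\<close> and \<open>g\<close> in \<open>V\<close> are closed and cover
  \<open>V\<close>.\<close>

lemma algebraic_variety_mult_eq_0:
  assumes V: "algebraic_variety V" and f: "f \<in> polynomial_functions" and g: "g \<in> polynomial_functions"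
    and fg: "\<And>p. p \<in> V \<Longrightarrow> f p * g p = 0"
  shows "(\<forall>p\<in>V. f p = 0) \<or> (\<forall>p\<in>V. g p = 0)"
proof -
  from V obtain F where F: "F \<subseteq> polynomial_functions" "V = {p. \<forall>f\<in>F. f p = 0}"
    unfolding algebraic_variety_def zariski_closed_def by blast
  have closed: "zariski_closed {p\<in>V. h p = 0}" if "h \<in> polynomial_functions" for h
    unfolding zariski_closed_def F(2) using that F(1) by (intro exI[of _ "insert h F"]) auto
  have "V = {p\<in>V. f p = 0} \<union> {p\<in>V. g p = 0}" using fg by auto
  then have "V = {p\<in>V. f p = 0} \<or> V = {p\<in>V. g p = 0}"
    using V closed[OF f] closed[OF g] unfolding algebraic_variety_def by blast
  then show ?thesis by blast
qed

text \<open>If neither of two polynomial functions vanishes identically on \<open>V\<close>, restrict both to a curve through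
  a nonzero of the first and a nonzero of the second: their product is a nonzero univariate polynomial.\<close>

lemma algebraic_varietyI_curves:
  assumes closed: "zariski_closed V" and ne: "V \<noteq> {}"
    and curve: "\<And>x y. x \<in> V \<Longrightarrow> y \<in> V \<Longrightarrow> \<exists>\<gamma>. (\<forall>t. (\<chi> i. poly (\<gamma> i) t) \<in> V) \<and>
        (\<chi> i. poly (\<gamma> i) 0) = x \<and> (\<chi> i. poly (\<gamma> i) 1) = y"
  shows "algebraic_variety V"
  unfolding algebraic_variety_def
proof (intro conjI closed ne allI impI)
  fix X Y assume X: "zariski_closed X" and Y: "zariski_closed Y" and V: "V = X \<union> Y"
  show "V = X \<or> V = Y"
  proof (rule ccontr)
    assume "\<not> (V = X \<or> V = Y)"
    then obtain x y where x: "x \<in> V" "x \<notin> X" and y: "y \<in> V" "y \<notin> Y" using V by blast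
    from X obtain F where F: "F \<subseteq> polynomial_functions" "X = {p. \<forall>f\<in>F. f p = 0}"
      unfolding zariski_closed_def by blast
    from Y obtain G where G: "G \<subseteq> polynomial_functions" "Y = {p. \<forall>f\<in>G. f p = 0}"
      unfolding zariski_closed_def by blast
    from F x obtain f where f: "f \<in> F" "f x \<noteq> 0" by auto
    from G y obtain g where g: "g \<in> G" "g y \<noteq> 0" by auto
    obtain \<gamma> where \<gamma>: "\<And>t. (\<chi> i. poly (\<gamma> i) t) \<in> V" "(\<chi> i. poly (\<gamma> i) 0) = x" "(\<chi> i. poly (\<gamma> i) 1) = y"
      using curve[OF x(1) y(1)] by blast
    obtain p where p: "\<And>t. f (\<chi> i. poly (\<gamma> i) t) = poly p t"
      using polynomial_function_on_curve f F by blast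
    obtain q where q: "\<And>t. g (\<chi> i. poly (\<gamma> i) t) = poly q t"
      using polynomial_function_on_curve g G by blast
    have "poly (p * q) t = 0" for t
      using \<gamma>(1)[of t] f(1) g(1) F(2) G(2) V by (auto simp: p[symmetric] q[symmetric])
    then have "p * q = 0" using poly_all_0_iff_0 by blast
    moreover have "p \<noteq> 0" using f(2) p[of 0] \<gamma>(2) by auto
    moreover have "q \<noteq> 0" using g(2) q[of 1] \<gamma>(3) by auto
    ultimately show False by simp
  qed
qed

lemma algebraic_variety_image:
  assumes L: "polynomial_map L" and L': "polynomial_map L'"
    and LL': "\<And>p. L (L' p) = p" and L'L: "\<And>p. L' (L p) = p" and V: "algebraic_variety V"
  shows "algebraic_variety (L ` V)"
  unfolding algebraic_variety_def
proof (intro conjI allI impI)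
  have "L ` V = L' -` V" using LL' L'L by (auto simp: image_iff) metis
  then show "zariski_closed (L ` V)"
    using V zariski_closed_vimage[OF _ L'] by (simp add: algebraic_variety_def)
  show "L ` V \<noteq> {}" using V by (simp add: algebraic_variety_def)
  fix X Y assume X: "zariski_closed X" and Y: "zariski_closed Y" and XY: "L ` V = X \<union> Y"
  have "V = L -` X \<union> L -` Y"
  proof -
    have "V = L -` (L ` V)" using L'L by (auto simp: image_iff) metis
    then show ?thesis unfolding XY by auto
  qed
  then have "V = L -` X \<or> V = L -` Y"
    using V zariski_closed_vimage[OF X L] zariski_closed_vimage[OF Y L] unfolding algebraic_variety_def by blast
  moreover have "L ` (L -` A) = A" for A using LL' by (metis surjI surj_image_vimage_eq)
  ultimately show "L ` V = X \<or> L ` V = Y" by metis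
qed

text \<open>Chains are carried over by \<open>L\<close>, and injectivity keeps the inclusions
  strict; the same argument for the inverse map then yields equality.\<close>

lemma variety_dim_image_le:
  assumes L: "polynomial_map L" and L': "polynomial_map L'"
    and LL': "\<And>p. L (L' p) = p" and L'L: "\<And>p. L' (L p) = p"
  shows "variety_dim V \<le> variety_dim (L ` V)"
  unfolding variety_dim_def
proof (rule Sup_subset_mono, safe)
  fix n Z assume Z: "\<forall>i\<le>n. algebraic_variety (Z i) \<and> Z i \<subseteq> V" "\<forall>i<n. Z i \<subset> Z (Suc i)"
  have "inj L" using L'L by (metis injI)
  then have "\<forall>i<n. L ` Z i \<subset> L ` Z (Suc i)"
    using Z(2) by (auto simp: psubset_eq inj_image_subset_iff inj_image_eq_iff)
  moreover have "\<forall>i\<le>n. algebraic_variety (L ` Z i) \<and> L ` Z i \<subseteq> L ` V"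
    using Z(1) algebraic_variety_image[OF L L' LL' L'L] by blast
  ultimately show "\<exists>m. enat n = enat m \<and> (\<exists>Z. (\<forall>i\<le>m. algebraic_variety (Z i) \<and> Z i \<subseteq> L ` V) \<and> (\<forall>i<m. Z i \<subset> Z (Suc i)))"
    by (intro exI[of _ n] conjI refl exI[of _ "\<lambda>i. L ` Z i"])
qed

lemma variety_dim_image:
  assumes L: "polynomial_map L" and L': "polynomial_map L'"
    and LL': "\<And>p. L (L' p) = p" and L'L: "\<And>p. L' (L p) = p"
  shows "variety_dim (L ` V) = variety_dim V"
proof (rule antisym)
  have "L' ` (L ` V) = V" by (simp add: image_image L'L)
  then show "variety_dim (L ` V) \<le> variety_dim V"
    using variety_dim_image_le[OF L' L L'L LL', of "L ` V"] by simp
  show "variety_dim V \<le> variety_dim (L ` V)" by (rule variety_dim_image_le[OF assms])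
qed

section \<open>Algebraic independence and counting of monomials\<close>

definition exponents :: "nat \<Rightarrow> nat \<Rightarrow> nat list set" where
  "exponents D n = {es. set es \<subseteq> {..D} \<and> length es = n}"

lemma finite_exponents: "finite (exponents D n)"
  unfolding exponents_def by (rule finite_lists_length_eq) simp

text \<open>Bounding each exponent separately, rather than their sum, makes the count an exact
  power, to be compared with a box of monomials.\<close>

lemma card_exponents: "card (exponents D n) = Suc D ^ n"
  unfolding exponents_def by (subst card_lists_length_eq) auto

lemma sum_exponents_Suc:
  "(\<Sum>es\<in>exponents D (Suc n). g es) = (\<Sum>e\<le>D. \<Sum>es\<in>exponents D n. g (e # es))"
proof -
  have *: "exponents D (Suc n) = (\<lambda>(e, es). e # es) ` ({..D} \<times> exponents D n)"
    by (auto simp: exponents_def length_Suc_conv image_iff)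
  have "inj_on (\<lambda>(e :: nat, es). e # es) ({..D} \<times> exponents D n)" by (auto simp: inj_on_def)
  then show ?thesis
    unfolding * by (simp add: sum.reindex sum.cartesian_product case_prod_unfold)
qed

fun power_product :: "('a \<Rightarrow> complex) list \<Rightarrow> nat list \<Rightarrow> 'a \<Rightarrow> complex" where
  "power_product (f # fs) (e # es) p = f p ^ e * power_product fs es p"
| "power_product _ _ p = 1"

lemma power_product_Nil: "power_product [] es = (\<lambda>p. 1)" "power_product fs [] = (\<lambda>p. 1)"
  by (rule ext, cases es; simp) (rule ext, cases fs; simp)

lemma polynomial_functions_power_product:
  "set fs \<subseteq> polynomial_functions \<Longrightarrow> power_product fs es \<in> polynomial_functions"
proof (induction fs es rule: list_induct2')
  case (4 f fs e es)
  then have "(\<lambda>p. f p ^ e * power_product fs es p) \<in> polynomial_functions"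
    by (intro polynomial_functions.mult polynomial_functions_power) auto
  then show ?case by (simp flip: power_product.simps(1))
qed (auto simp: power_product_Nil intro: polynomial_functions.const)

text \<open>Functions \<open>f\<^sub>i\<close> that vanish on \<open>Z\<^sub>i\<close> but not on \<open>Z\<^bsub>i+1\<^esub>\<close> are algebraically independent on the
  largest member of the chain: in a relation, cancel the lowest occurring power of the last function and
  restrict to the previous member.\<close>

lemma chain_algebraically_independent:
  assumes "\<And>i. i \<le> n \<Longrightarrow> algebraic_variety (Z i)" "\<And>i. i < n \<Longrightarrow> Z i \<subseteq> Z (Suc i)"
    "length fs = n" "set fs \<subseteq> polynomial_functions"
    "\<And>i p. i < n \<Longrightarrow> p \<in> Z i \<Longrightarrow> (fs ! (n - 1 - i)) p = 0"
    "\<And>i. i < n \<Longrightarrow> \<exists>p\<in>Z (Suc i). (fs ! (n - 1 - i)) p \<noteq> 0"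
    "\<And>p. p \<in> Z n \<Longrightarrow> (\<Sum>es\<in>exponents D n. c es * power_product fs es p) = 0"
    "es \<in> exponents D n"
  shows "c es = 0"
  using assms
proof (induction n arbitrary: fs c es)
  case 0
  from "0.prems"(1) obtain p where "p \<in> Z 0" by (auto simp: algebraic_variety_def)
  moreover have "exponents D 0 = {[]}" by (auto simp: exponents_def)
  ultimately show ?case using "0.prems"(3,7,8) by auto
next
  case (Suc n)
  \<comment> \<open>The list runs from the top of the chain downwards, hence the index
    \<open>n - 1 - i\<close>: its head separates the last two members and its tail serves the
    shorter chain.\<close>
  obtain f gs where fs: "fs = f # gs" and len: "length gs = n"
    using Suc.prems(3) by (auto simp: length_Suc_conv)
  have f: "f \<in> polynomial_functions" and gs: "set gs \<subseteq> polynomial_functions"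
    using Suc.prems(4) fs by auto
  have fZ: "p \<in> Z n \<Longrightarrow> f p = 0" for p using Suc.prems(5)[of n p] fs by simp
  have fS: "\<exists>p\<in>Z (Suc n). f p \<noteq> 0" using Suc.prems(6)[of n] fs by simp
  define G where "G e p = (\<Sum>es\<in>exponents D n. c (e # es) * power_product gs es p)" for e p
  have G: "G e \<in> polynomial_functions" for e
    unfolding G_def using gs
    by (intro polynomial_functions_sum polynomial_functions.mult polynomial_functions.const
        polynomial_functions_power_product)
  have rel: "(\<Sum>e\<le>D. f p ^ e * G e p) = 0" if "p \<in> Z (Suc n)" for p
    using Suc.prems(7)[OF that] unfolding sum_exponents_Suc fs G_def
    by (simp add: sum_distrib_left mult_ac)
  have nth: "gs ! (n - 1 - i) = fs ! (Suc n - 1 - i)" if "i < n" for i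
  proof -
    have "Suc n - 1 - i = Suc (n - 1 - i)" using that by simp
    then show ?thesis by (simp add: fs)
  qed
  have coeff: "c (e # es') = 0" if "e \<le> D" "es' \<in> exponents D n" for e es'
    using that
  proof (induction e arbitrary: es' rule: less_induct)
    case (less e)
    have low: "G e' p = 0" if "e' < e" for e' p
      unfolding G_def using less that by simp
    \<comment> \<open>\<open>H\<close> is the relation divided by \<open>f\<close> to the power
      \<open>e\<close>. It vanishes on \<open>Z (Suc n)\<close> by irreducibility, and on
      \<open>Z n\<close>, where \<open>f\<close> is 0, it reduces to \<open>G e\<close>.\<close>
    define H where "H p = (\<Sum>k\<le>D - e. f p ^ k * G (e + k) p)" for p
    have H: "H \<in> polynomial_functions"
      unfolding H_def using f G
      by (intro polynomial_functions_sum polynomial_functions.mult polynomial_functions_power)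
    have "f p ^ e * H p = 0" if "p \<in> Z (Suc n)" for p
    proof -
      have "(\<Sum>e'\<le>D. f p ^ e' * G e' p) = (\<Sum>e'\<in>{e..D}. f p ^ e' * G e' p)"
        by (rule sum.mono_neutral_right) (auto simp: low)
      also have "\<dots> = (\<Sum>k\<le>D - e. f p ^ (e + k) * G (e + k) p)"
        using less.prems(1)
        by (intro sum.reindex_bij_witness[of _ "\<lambda>k. e + k" "\<lambda>e'. e' - e"]) auto
      also have "\<dots> = f p ^ e * H p"
        by (simp add: H_def sum_distrib_left power_add mult.assoc)
      finally show ?thesis using rel[OF that] by simp
    qed
    then have "(\<forall>p\<in>Z (Suc n). f p ^ e = 0) \<or> (\<forall>p\<in>Z (Suc n). H p = 0)"
      using Suc.prems(1) f H
      by (intro algebraic_variety_mult_eq_0 polynomial_functions_power) auto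
    then have "\<forall>p\<in>Z (Suc n). H p = 0" using fS by auto
    then have "H p = 0" if "p \<in> Z n" for p using Suc.prems(2)[of n] that by auto
    moreover have "H p = G e p" if "p \<in> Z n" for p
    proof -
      have "H p = (\<Sum>k\<in>{0}. f p ^ k * G (e + k) p)"
        unfolding H_def by (rule sum.mono_neutral_right) (auto simp: fZ[OF that])
      then show ?thesis by simp
    qed
    ultimately have "G e p = 0" if "p \<in> Z n" for p using that by auto
    then show "c (e # es') = 0"
      using Suc.IH[of gs "\<lambda>es. c (e # es)" es'] Suc.prems(1,2,5,6) len gs nth less.prems(2)
      unfolding G_def by simp
  qed
  from Suc.prems(8) obtain e es' where "es = e # es'" "e \<le> D" "es' \<in> exponents D n"
    by (auto simp: exponents_def length_Suc_conv)
  then show ?case using coeff by simp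
qed

text \<open>Gaussian elimination over arbitrary finite index sets, pivoting on a nonzero entry of
  the added equation. It will produce a linear relation among power products that outnumber the
  available monomials.\<close>

lemma homogeneous_system_nontrivial_solution:
  fixes M :: "'i \<Rightarrow> 'j \<Rightarrow> 'a::field"
  assumes "finite I" "finite J" "card I < card J"
  shows "\<exists>c. (\<exists>j\<in>J. c j \<noteq> 0) \<and> (\<forall>i\<in>I. (\<Sum>j\<in>J. c j * M i j) = 0)"
  using assms
proof (induction I arbitrary: J M rule: finite_induct)
  case empty
  then have "J \<noteq> {}" by auto
  then show ?case by (intro exI[of _ "\<lambda>_. 1"]) auto
next
  case (insert r I)
  show ?case
  proof (cases "\<forall>j\<in>J. M r j = 0")
    case True
    obtain c where "\<exists>j\<in>J. c j \<noteq> 0" "\<forall>i\<in>I. (\<Sum>j\<in>J. c j * M i j) = 0"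
      using insert.IH[of J M] insert by fastforce
    then show ?thesis using True by (intro exI[of _ c]) auto
  next
    case False
    then obtain k where k: "k \<in> J" "M r k \<noteq> 0" by blast
    define J' where "J' = J - {k}"
    have J: "J = insert k J'" "k \<notin> J'" "finite J'" using k insert.prems by (auto simp: J'_def)
    define M' where "M' i j = M i j - M i k * M r j / M r k" for i j
    have "card I < card J'" using insert J by simp
    from insert.IH[OF J(3) this, of M'] obtain c where
      c: "\<exists>j\<in>J'. c j \<noteq> 0" "\<forall>i\<in>I. (\<Sum>j\<in>J'. c j * M' i j) = 0" by blast
    define x where "x = - (\<Sum>j\<in>J'. c j * M r j) / M r k"
    have sum: "(\<Sum>j\<in>J. (c(k := x)) j * M i j) = x * M i k + (\<Sum>j\<in>J'. c j * M i j)" for i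
    proof -
      have "(\<Sum>j\<in>J'. (c(k := x)) j * M i j) = (\<Sum>j\<in>J'. c j * M i j)"
        by (rule sum.cong) (use J in auto)
      then show ?thesis using J by simp
    qed
    have "(\<Sum>j\<in>J'. c j * M' i j) = (\<Sum>j\<in>J'. c j * M i j) + x * M i k" for i
      unfolding M'_def x_def by (simp add: algebra_simps sum_subtractf sum_distrib_left sum_divide_distrib)
    then have "\<forall>i\<in>I. (\<Sum>j\<in>J. (c(k := x)) j * M i j) = 0" using c(2) unfolding sum by (simp add: add.commute)
    moreover have "(\<Sum>j\<in>J. (c(k := x)) j * M r j) = 0" unfolding sum using k by (simp add: x_def)
    moreover have "\<exists>j\<in>J. (c(k := x)) j \<noteq> 0" using c(1) J by auto
    ultimately show ?thesis by (intro exI[of _ "c(k := x)"]) blast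
  qed
qed

text \<open>Polynomials in three variables of degree at most \<open>N\<close> in each variable
  separately, so that they have \<open>(N + 1)^3\<close> coefficients. Generating them from
  monomials opens products to induction.\<close>

inductive box_degree :: "nat \<Rightarrow> (complex \<Rightarrow> complex \<Rightarrow> complex \<Rightarrow> complex) \<Rightarrow> bool" for N where
  monomial: "i \<le> N \<Longrightarrow> j \<le> N \<Longrightarrow> k \<le> N \<Longrightarrow> box_degree N (\<lambda>x y z. c * (x ^ i * y ^ j * z ^ k))"
| add: "box_degree N g \<Longrightarrow> box_degree N h \<Longrightarrow> box_degree N (\<lambda>x y z. g x y z + h x y z)"

lemma box_degree_mono: "box_degree N g \<Longrightarrow> N \<le> M \<Longrightarrow> box_degree M g"
  by (induction rule: box_degree.induct) (auto intro: box_degree.intros)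

lemma box_degree_mult:
  assumes "box_degree N g" "box_degree M h"
  shows "box_degree (N + M) (\<lambda>x y z. g x y z * h x y z)"
  using assms(1)
proof induction
  case (monomial i j k c)
  show ?case using assms(2)
  proof induction
    case (monomial i' j' k' c')
    have "box_degree (N + M) (\<lambda>x y z. (c * c') * (x ^ (i + i') * y ^ (j + j') * z ^ (k + k')))"
      using monomial \<open>i \<le> N\<close> \<open>j \<le> N\<close> \<open>k \<le> N\<close> by (intro box_degree.monomial) auto
    then show ?case by (simp add: power_add mult_ac)
  next
    case (add g h)
    then show ?case using box_degree.add by (fastforce simp: distrib_left)
  qed
next
  case (add g h)
  then show ?case using box_degree.add by (fastforce simp: distrib_right)
qed

lemma box_degree_const: "box_degree N (\<lambda>x y z. c)"
  using box_degree.monomial[of 0 N 0 0 c] by simp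

lemma box_degree_power: "box_degree N g \<Longrightarrow> box_degree (e * N) (\<lambda>x y z. g x y z ^ e)"
proof (induction e)
  case (Suc e)
  then show ?case using box_degree_mult[of N g "e * N" "\<lambda>x y z. g x y z ^ e"] by simp
qed (simp add: box_degree_const)

lemma box_degree_coeffs:
  "box_degree N g \<Longrightarrow> \<exists>C. \<forall>x y z. g x y z = (\<Sum>(i, j, k)\<in>{..N} \<times> {..N} \<times> {..N}. C (i, j, k) * (x ^ i * y ^ j * z ^ k))"
proof (induction rule: box_degree.induct)
  case (monomial i j k c)
  have "c * (x ^ i * y ^ j * z ^ k) = (\<Sum>(i', j', k')\<in>{..N} \<times> {..N} \<times> {..N}.
      (if (i', j', k') = (i, j, k) then c else 0) * (x ^ i' * y ^ j' * z ^ k'))" for x y z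
  proof -
    have "(\<Sum>(i', j', k')\<in>{..N} \<times> {..N} \<times> {..N}.
      (if (i', j', k') = (i, j, k) then c else 0) * (x ^ i' * y ^ j' * z ^ k'))
      = (\<Sum>m\<in>{..N} \<times> {..N} \<times> {..N}. if m = (i, j, k) then c * (x ^ i * y ^ j * z ^ k) else 0)"
    proof (rule sum.cong)
      fix m assume "m \<in> {..N} \<times> {..N} \<times> {..N}"
      show "(case m of (i', j', k') \<Rightarrow> (if (i', j', k') = (i, j, k) then c else 0) * (x ^ i' * y ^ j' * z ^ k'))
          = (if m = (i, j, k) then c * (x ^ i * y ^ j * z ^ k) else 0)"
        by (cases m) auto
    qed simp
    then show ?thesis using monomial by simp
  qed
  then show ?case by (intro exI[of _ "\<lambda>m. if m = (i, j, k) then c else 0"]) blast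
next
  case (add g h)
  then obtain C C' where
    "\<forall>x y z. g x y z = (\<Sum>(i, j, k)\<in>{..N} \<times> {..N} \<times> {..N}. C (i, j, k) * (x ^ i * y ^ j * z ^ k))"
    "\<forall>x y z. h x y z = (\<Sum>(i, j, k)\<in>{..N} \<times> {..N} \<times> {..N}. C' (i, j, k) * (x ^ i * y ^ j * z ^ k))"
    by blast
  then show ?case
    by (intro exI[of _ "\<lambda>m. C m + C' m"]) (simp add: case_prod_unfold distrib_right sum.distrib)
qed

section \<open>The quadric cone and its parametrizations\<close>

text \<open>The singular 2 by 2 matrices with rows \<open>(p2, p4)\<close> and
  \<open>(p5, p3)\<close>. The first coordinate keeps the cone inside five-space, where invertible
  affine maps lead to the members of the orbit.\<close>

definition quadric_cone :: "(complex^5) set" where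
  "quadric_cone = {p. p $ 1 = 0 \<and> p $ 2 * p $ 3 = p $ 4 * p $ 5}"

text \<open>A matrix of rank at most 1 is a column \<open>(s, t)\<close> times a row
  \<open>(\<alpha>, \<beta>)\<close>; the cases look for a nonzero entry in the first row.\<close>

lemma cone_parametrization:
  assumes "p \<in> quadric_cone"
  obtains s t \<alpha> \<beta> where "p = vector [0, s * \<alpha>, t * \<beta>, s * \<beta>, t * \<alpha>]"
proof -
  have p: "p $ 1 = 0" "p $ 2 * p $ 3 = p $ 4 * p $ 5" using assms by (auto simp: quadric_cone_def)
  consider "p $ 2 \<noteq> 0" | "p $ 2 = 0" "p $ 4 \<noteq> 0" | "p $ 2 = 0" "p $ 4 = 0" by blast
  then show ?thesis
  proof cases
    case 1
    then show ?thesis using p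
      by (intro that[of 1 "p $ 2" "p $ 5 / p $ 2" "p $ 4"]) (simp add: vec_eq_5 field_simps)
  next
    case 2
    then show ?thesis using p
      by (intro that[of 1 0 "p $ 3 / p $ 4" "p $ 4"]) (auto simp add: vec_eq_5)
  next
    case 3
    then show ?thesis using p
      by (intro that[of 0 "p $ 5" 1 "p $ 3"]) (auto simp add: vec_eq_5)
  qed
qed

text \<open>The parametrization at \<open>s = 1\<close>. It has only three parameters, as the degree
  count requires, at the price of missing the nonzero points with
  \<open>p2 = p4 = 0\<close>.\<close>

definition cone_chart :: "complex \<Rightarrow> complex \<Rightarrow> complex \<Rightarrow> complex^5" where
  "cone_chart t \<alpha> \<beta> = vector [0, \<alpha>, t * \<beta>, \<beta>, t * \<alpha>]"

lemma box_degree_cone_chart: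
  assumes "f \<in> polynomial_functions"
  shows "\<exists>N. box_degree N (\<lambda>t \<alpha> \<beta>. f (cone_chart t \<alpha> \<beta>))"
  using assms
proof induction
  case (const c)
  show ?case using box_degree_const by blast
next
  case (coord i)
  have "box_degree 1 (\<lambda>t \<alpha> \<beta>. 0)" by (rule box_degree_const)
  moreover have "box_degree 1 (\<lambda>t \<alpha> \<beta>. \<alpha>)" using box_degree.monomial[of 0 1 1 0 1] by simp
  moreover have "box_degree 1 (\<lambda>t \<alpha> \<beta>. t * \<beta>)" using box_degree.monomial[of 1 1 0 1 1] by simp
  moreover have "box_degree 1 (\<lambda>t \<alpha> \<beta>. \<beta>)" using box_degree.monomial[of 0 1 0 1 1] by simp
  moreover have "box_degree 1 (\<lambda>t \<alpha> \<beta>. t * \<alpha>)" using box_degree.monomial[of 1 1 1 0 1] by simp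
  ultimately have "\<forall>i. box_degree 1 (\<lambda>t \<alpha> \<beta>. cone_chart t \<alpha> \<beta> $ i)"
    unfolding forall_5 cone_chart_def vector_5 by blast
  then show ?case by blast
next
  case (add f g)
  then obtain N M where "box_degree N (\<lambda>t \<alpha> \<beta>. f (cone_chart t \<alpha> \<beta>))"
    "box_degree M (\<lambda>t \<alpha> \<beta>. g (cone_chart t \<alpha> \<beta>))" by blast
  then have "box_degree (max N M) (\<lambda>t \<alpha> \<beta>. f (cone_chart t \<alpha> \<beta>))"
    "box_degree (max N M) (\<lambda>t \<alpha> \<beta>. g (cone_chart t \<alpha> \<beta>))"
    by (auto intro: box_degree_mono)
  then show ?case using box_degree.add by blast
next
  case (mult f g)
  then show ?case using box_degree_mult by blast
qed

text \<open>The chart is dense: for fixed \<open>t\<close>, \<open>\<alpha>\<close>,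
  \<open>\<beta>\<close> every point with \<open>s \<noteq> 0\<close> lies in it after rescaling,
  and a polynomial in \<open>s\<close> that vanishes for all nonzero \<open>s\<close> vanishes at
  0.\<close>

lemma polynomial_function_zero_on_cone:
  assumes f: "f \<in> polynomial_functions" and zero: "\<And>t \<alpha> \<beta>. f (cone_chart t \<alpha> \<beta>) = 0" and p: "p \<in> quadric_cone"
  shows "f p = 0"
proof -
  from p obtain s t \<alpha> \<beta> where p: "p = vector [0, s * \<alpha>, t * \<beta>, s * \<beta>, t * \<alpha>]"
    by (rule cone_parametrization)
  define \<gamma> :: "5 \<Rightarrow> complex poly"
    where "\<gamma> i = vector [0, [:0, \<alpha>:], [:t * \<beta>:], [:0, \<beta>:], [:t * \<alpha>:]] $ i" for i
  have \<gamma>: "(\<chi> i. poly (\<gamma> i) x) = vector [0, x * \<alpha>, t * \<beta>, x * \<beta>, t * \<alpha>]" for x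
    by (simp add: vec_eq_5 \<gamma>_def)
  obtain g where g: "\<And>x. f (\<chi> i. poly (\<gamma> i) x) = poly g x"
    using polynomial_function_on_curve[OF f] by blast
  have "poly g x = 0" if "x \<noteq> 0" for x
  proof -
    have "vector [0, x * \<alpha>, t * \<beta>, x * \<beta>, t * \<alpha>] = cone_chart (t / x) (x * \<alpha>) (x * \<beta>)"
      unfolding cone_chart_def using that by (simp add: vec_eq_5)
    then show ?thesis using zero g[of x] unfolding \<gamma> by simp
  qed
  then have "UNIV - {0} \<subseteq> {x. poly g x = 0}" by blast
  moreover have "infinite (UNIV - {0 :: complex})" using infinite_UNIV_char_0 by simp
  ultimately have "g = 0" using poly_roots_finite finite_subset by blast
  then show ?thesis using g[of s] unfolding \<gamma> p by simp
qed

lemma box_degree_power_product: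
  assumes "set es \<subseteq> {..D}" "\<And>f. f \<in> set fs \<Longrightarrow> box_degree N (\<lambda>t \<alpha> \<beta>. f (\<psi> t \<alpha> \<beta>))"
  shows "box_degree (length fs * (D * N)) (\<lambda>t \<alpha> \<beta>. power_product fs es (\<psi> t \<alpha> \<beta>))"
  using assms
proof (induction fs es rule: list_induct2')
  case (4 f fs e es)
  have "box_degree (e * N) (\<lambda>t \<alpha> \<beta>. f (\<psi> t \<alpha> \<beta>) ^ e)" using 4 by (intro box_degree_power) auto
  then have "box_degree (D * N) (\<lambda>t \<alpha> \<beta>. f (\<psi> t \<alpha> \<beta>) ^ e)" by (rule box_degree_mono) (use 4 in auto)
  from box_degree_mult[OF this] 4 show ?case by simp
qed (auto intro: box_degree_const)

text \<open>The polynomial functions of degree at most \<open>m\<close> on the quadric cone span a space of dimension \<open>O(m\<^sup>3)\<close>,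
  while four algebraically independent functions would produce on the order of \<open>m\<^sup>4\<close> linearly independent ones.\<close>

lemma cone_no_chain_4:
  assumes Z: "\<And>i. i \<le> 4 \<Longrightarrow> algebraic_variety (Z i)" "Z 4 \<subseteq> quadric_cone" "\<And>i. i < 4 \<Longrightarrow> Z i \<subset> Z (Suc i)"
  shows False
proof -
  have "\<exists>f\<in>polynomial_functions. (\<forall>p\<in>Z i. f p = 0) \<and> (\<exists>p\<in>Z (Suc i). f p \<noteq> 0)" if "i < 4" for i
  proof -
    from Z(1)[of i] that obtain F where F: "F \<subseteq> polynomial_functions" "Z i = {p. \<forall>f\<in>F. f p = 0}"
      unfolding algebraic_variety_def zariski_closed_def by auto
    from Z(3)[OF that] obtain p where "p \<in> Z (Suc i)" "p \<notin> Z i" by blast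
    with F show ?thesis by blast
  qed
  then obtain g where g: "\<And>i. i < 4 \<Longrightarrow> g i \<in> polynomial_functions" "\<And>i p. i < 4 \<Longrightarrow> p \<in> Z i \<Longrightarrow> g i p = 0"
    "\<And>i. i < 4 \<Longrightarrow> \<exists>p\<in>Z (Suc i). g i p \<noteq> 0" by metis
  define fs where "fs = [g 3, g 2, g 1, g 0]"
  have fs: "set fs \<subseteq> polynomial_functions" "length fs = 4" using g(1) by (auto simp: fs_def)
  have nth: "fs ! (4 - 1 - i) = g i" if "i < 4" for i
  proof -
    have "i = 0 \<or> i = 1 \<or> i = 2 \<or> i = 3" using that by auto
    then show ?thesis by (auto simp: fs_def)
  qed
  obtain N where N: "\<And>f. f \<in> set fs \<Longrightarrow> box_degree N (\<lambda>t \<alpha> \<beta>. f (cone_chart t \<alpha> \<beta>))"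
  proof -
    have "\<forall>f\<in>set fs. \<exists>N. box_degree N (\<lambda>t \<alpha> \<beta>. f (cone_chart t \<alpha> \<beta>))"
      using fs(1) box_degree_cone_chart by blast
    then obtain d where "\<forall>f\<in>set fs. box_degree (d f) (\<lambda>t \<alpha> \<beta>. f (cone_chart t \<alpha> \<beta>))" by metis
    then show ?thesis
      by (intro that[of "Max (d ` set fs)"]) (auto intro: box_degree_mono)
  qed
  \<comment> \<open>The power products have degree at most \<open>4 D N\<close> in each variable.
    Cubing \<open>4 D N + 1 \<le> (4 N + 1) (D + 1)\<close> bounds the number of monomials by
    \<open>D (D + 1)^3\<close>, below the number \<open>(D + 1)^4\<close> of power products.\<close>
  define D where "D = (4 * N + 1) ^ 3"
  define B where "B = {..4 * (D * N)} \<times> {..4 * (D * N)} \<times> {..4 * (D * N)}"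
  have "\<forall>es\<in>exponents D 4. \<exists>C. \<forall>x y z. power_product fs es (cone_chart x y z) =
      (\<Sum>(i, j, k)\<in>B. C (i, j, k) * (x ^ i * y ^ j * z ^ k))"
  proof
    fix es assume "es \<in> exponents D 4"
    then have "set es \<subseteq> {..D}" by (simp add: exponents_def)
    from box_degree_coeffs[OF box_degree_power_product[where fs = fs and \<psi> = cone_chart, OF this N]]
    show "\<exists>C. \<forall>x y z. power_product fs es (cone_chart x y z) =
      (\<Sum>(i, j, k)\<in>B. C (i, j, k) * (x ^ i * y ^ j * z ^ k))"
      by (simp only: B_def fs(2))
  qed
  from bchoice[OF this] obtain C where C: "\<And>es x y z. es \<in> exponents D 4 \<Longrightarrow> power_product fs es (cone_chart x y z) =
      (\<Sum>(i, j, k)\<in>B. C es (i, j, k) * (x ^ i * y ^ j * z ^ k))"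
    by blast
  have "card B = (4 * (D * N) + 1) ^ 3" by (simp add: B_def card_cartesian_product power3_eq_cube)
  also have "\<dots> \<le> ((4 * N + 1) * Suc D) ^ 3" by (intro power_mono) (auto simp: algebra_simps)
  also have "\<dots> = D * Suc D ^ 3" by (simp only: power_mult_distrib D_def[symmetric])
  also have "\<dots> < Suc D * Suc D ^ 3" by (intro mult_strict_right_mono) auto
  also have "\<dots> = card (exponents D 4)" unfolding card_exponents power_Suc[symmetric] by simp
  finally have "card B < card (exponents D 4)" .
  from homogeneous_system_nontrivial_solution[OF _ finite_exponents this, of "\<lambda>m es. C es m"]
  obtain c where c: "\<exists>es\<in>exponents D 4. c es \<noteq> 0" "\<And>m. m \<in> B \<Longrightarrow> (\<Sum>es\<in>exponents D 4. c es * C es m) = 0"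
    by (auto simp: B_def)
  define G where "G p = (\<Sum>es\<in>exponents D 4. c es * power_product fs es p)" for p
  have "G (cone_chart x y z) = 0" for x y z
  proof -
    have "G (cone_chart x y z) = (\<Sum>es\<in>exponents D 4. \<Sum>(i, j, k)\<in>B. c es * C es (i, j, k) * (x ^ i * y ^ j * z ^ k))"
      unfolding G_def by (simp add: C sum_distrib_left case_prod_unfold mult.assoc)
    also have "\<dots> = (\<Sum>(i, j, k)\<in>B. (\<Sum>es\<in>exponents D 4. c es * C es (i, j, k)) * (x ^ i * y ^ j * z ^ k))"
      by (subst sum.swap) (simp add: case_prod_unfold sum_distrib_right)
    also have "\<dots> = 0" using c(2) by (intro sum.neutral) auto
    finally show ?thesis .
  qed
  moreover have "G \<in> polynomial_functions"
    unfolding G_def using fs(1)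
    by (intro polynomial_functions_sum polynomial_functions.mult polynomial_functions.const
        polynomial_functions_power_product)
  ultimately have "p \<in> Z 4 \<Longrightarrow> G p = 0" for p
    using polynomial_function_zero_on_cone Z(2) by blast
  note G = this[unfolded G_def]
  have "c es = 0" if "es \<in> exponents D 4" for es
    by (rule chain_algebraically_independent[of 4 Z fs, OF _ _ fs(2,1) _ _ G that])
      (simp_all only: Z(1) psubset_imp_subset[OF Z(3)] nth g)
  then show False using c(1) by blast
qed

section \<open>The cone is irreducible of dimension three\<close>

lemma zariski_closed_zeros:
  "F \<subseteq> polynomial_functions \<Longrightarrow> zariski_closed {p. \<forall>f\<in>F. f p = 0}"
  unfolding zariski_closed_def by blast

text \<open>Interpolating the parameters \<open>s\<close>, \<open>t\<close>,
  \<open>\<alpha>\<close>, \<open>\<beta>\<close> linearly joins any two points by a polynomial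
  curve inside the cone.\<close>

lemma algebraic_variety_cone: "algebraic_variety quadric_cone"
proof (rule algebraic_varietyI_curves)
  have "zariski_closed {p :: complex^5. \<forall>f\<in>{\<lambda>p. p $ 1, \<lambda>p. p $ 2 * p $ 3 - p $ 4 * p $ 5}. f p = 0}"
    by (intro zariski_closed_zeros)
      (auto intro!: polynomial_functions_diff intro: polynomial_functions.intros)
  then show "zariski_closed quadric_cone" by (simp add: quadric_cone_def)
  have "0 \<in> quadric_cone" by (simp add: quadric_cone_def)
  then show "quadric_cone \<noteq> {}" by blast
  fix x y :: "complex^5" assume "x \<in> quadric_cone" "y \<in> quadric_cone"
  obtain s t \<alpha> \<beta> where x: "x = vector [0, s * \<alpha>, t * \<beta>, s * \<beta>, t * \<alpha>]"
    using \<open>x \<in> quadric_cone\<close> by (rule cone_parametrization)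
  obtain s' t' \<alpha>' \<beta>' where y: "y = vector [0, s' * \<alpha>', t' * \<beta>', s' * \<beta>', t' * \<alpha>']"
    using \<open>y \<in> quadric_cone\<close> by (rule cone_parametrization)
  define S T A B where "S = [:s, s' - s:]" and "T = [:t, t' - t:]" and "A = [:\<alpha>, \<alpha>' - \<alpha>:]"
    and "B = [:\<beta>, \<beta>' - \<beta>:]"
  define \<gamma> where "\<gamma> i = vector [0, S * A, T * B, S * B, T * A] $ i" for i :: 5
  have ends: "poly S 0 = s" "poly S 1 = s'" "poly T 0 = t" "poly T 1 = t'"
    "poly A 0 = \<alpha>" "poly A 1 = \<alpha>'" "poly B 0 = \<beta>" "poly B 1 = \<beta>'"
    by (simp_all add: S_def T_def A_def B_def)
  show "\<exists>\<gamma>. (\<forall>t. (\<chi> i. poly (\<gamma> i) t) \<in> quadric_cone) \<and> (\<chi> i. poly (\<gamma> i) 0) = x \<and> (\<chi> i. poly (\<gamma> i) 1) = y"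
    by (rule exI[of _ \<gamma>]) (simp add: quadric_cone_def vec_eq_5 x y \<gamma>_def ends mult_ac)
qed

lemma algebraic_variety_coordinate_subspace:
  "algebraic_variety {p :: complex^'n. \<forall>i\<in>I. p $ i = 0}"
proof (rule algebraic_varietyI_curves)
  have "zariski_closed {p :: complex^'n. \<forall>f\<in>(\<lambda>i p. p $ i) ` I. f p = 0}"
    by (intro zariski_closed_zeros) (auto intro: polynomial_functions.intros)
  then show "zariski_closed {p :: complex^'n. \<forall>i\<in>I. p $ i = 0}" by simp
  have "(0 :: complex^'n) \<in> {p. \<forall>i\<in>I. p $ i = 0}" by simp
  then show "{p :: complex^'n. \<forall>i\<in>I. p $ i = 0} \<noteq> {}" by blast
  fix x y :: "complex^'n" assume "x \<in> {p. \<forall>i\<in>I. p $ i = 0}" "y \<in> {p. \<forall>i\<in>I. p $ i = 0}"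
  then show "\<exists>\<gamma>. (\<forall>t. (\<chi> i. poly (\<gamma> i) t) \<in> {p. \<forall>i\<in>I. p $ i = 0}) \<and>
      (\<chi> i. poly (\<gamma> i) 0) = x \<and> (\<chi> i. poly (\<gamma> i) 1) = y"
    by (intro exI[of _ "\<lambda>i. [:x $ i, y $ i - x $ i:]"]) (simp add: vec_eq_iff)
qed

lemma variety_dim_cone: "variety_dim quadric_cone = 3"
proof (rule antisym)
  show "variety_dim quadric_cone \<le> 3"
    unfolding variety_dim_def
  proof (rule Sup_least, safe)
    fix n and Z :: "nat \<Rightarrow> (complex^5) set"
    assume Z: "\<forall>i\<le>n. algebraic_variety (Z i) \<and> Z i \<subseteq> quadric_cone" "\<forall>i<n. Z i \<subset> Z (Suc i)"
    have "\<not> 4 \<le> n" using cone_no_chain_4[of Z] Z by auto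
    then show "enat n \<le> 3" by (simp add: numeral_eq_enat)
  qed
  \<comment> \<open>A chain of length 3: the vertex, the \<open>p2\<close>-axis, the plane of
    \<open>p2\<close> and \<open>p5\<close>, and the cone.\<close>
  define Z :: "nat \<Rightarrow> (complex^5) set" where
    "Z i = (if i = 3 then quadric_cone else {p. \<forall>j\<in>(if i = 0 then UNIV else if i = 1 then {1, 3, 4, 5} else {1, 3, 4}). p $ j = 0})" for i
  have "algebraic_variety (Z i)" for i
    unfolding Z_def using algebraic_variety_cone algebraic_variety_coordinate_subspace
    by (cases "i = 3") (simp_all only: if_True if_False simp_thms)
  moreover have "Z i \<subset> Z (Suc i)" if "i < 3" for i
  proof -
    have "vector [0, 1, 0, 0, 0] \<in> Z 1 - Z 0" "vector [0, 0, 0, 0, 1] \<in> Z 2 - Z 1" "vector [0, 0, 1, 0, 0] \<in> Z 3 - Z 2"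
      by (simp_all add: Z_def quadric_cone_def forall_5)
    moreover have "Z 0 \<subseteq> Z 1" "Z 1 \<subseteq> Z 2" "Z 2 \<subseteq> Z 3"
      by (auto simp: Z_def quadric_cone_def)
    moreover have "i = 0 \<or> i = 1 \<or> i = 2" using that by auto
    ultimately show ?thesis by (auto simp: numeral_2_eq_2 numeral_3_eq_3)
  qed
  moreover have "Z i \<subseteq> quadric_cone" if "i \<le> 3" for i
  proof -
    have "i = 0 \<or> i = 1 \<or> i = 2 \<or> i = 3" using that by auto
    then show ?thesis by (auto simp: Z_def quadric_cone_def)
  qed
  ultimately have "enat 3 \<in> {enat n | n. \<exists>Z :: nat \<Rightarrow> (complex^5) set.
     (\<forall>i\<le>n. algebraic_variety (Z i) \<and> Z i \<subseteq> quadric_cone) \<and> (\<forall>i<n. Z i \<subset> Z (Suc i))}"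
    by blast
  then show "3 \<le> variety_dim quadric_cone"
    unfolding variety_dim_def by (simp add: Sup_upper numeral_eq_enat)
qed


section \<open>The Thomae orbit\<close>

lemma polynomial_map_compose:
  assumes "polynomial_map f" "polynomial_map g"
  shows "polynomial_map (\<lambda>p. f (g p))"
  using polynomial_functions_compose[OF _ assms(2)] assms(1) unfolding polynomial_map_def by blast

abbreviation permute_coords :: "('n \<Rightarrow> 'n) \<Rightarrow> 'a^'n \<Rightarrow> 'a^'n" where
  "permute_coords \<sigma> p \<equiv> \<chi> i. p $ \<sigma> i"

lemma polynomial_map_permute_coords: "polynomial_map (permute_coords \<sigma>)"
  by (simp add: polynomial_map_def polynomial_functions.coord)

lemma polynomial_map_vector_matrix_mult: "polynomial_map (\<lambda>w. w v* A)"
  unfolding polynomial_map_def vector_matrix_mult_def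
  by (auto intro!: polynomial_functions_sum intro: polynomial_functions.intros)

lemma vector_thomae_matrix [simp]:
  "(w v* thomae_matrix) $ 1 = w $ 1 + w $ 4 + w $ 5"
  "(w v* thomae_matrix) $ 2 = w $ 2 + w $ 4 + w $ 5"
  "(w v* thomae_matrix) $ 3 = w $ 3 + w $ 4 + w $ 5"
  "(w v* thomae_matrix) $ 4 = w $ 1 + w $ 2 + w $ 3 + 2 * w $ 4 + w $ 5"
  "(w v* thomae_matrix) $ 5 = w $ 1 + w $ 2 + w $ 3 + w $ 4 + 2 * w $ 5"
  by (simp_all add: vector_matrix_mult_def sum_5 thomae_matrix_def)

text \<open>The inverse coordinate change: \<open>r\<close> is \<open>u + v\<close>, and
  \<open>u - v\<close> is \<open>d - e\<close>. Rational constants are written as factors, so that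
  the closure rules of \<open>polynomial_functions\<close> apply directly.\<close>

definition thomae_coords :: "complex^5 \<Rightarrow> complex^5" where
  "thomae_coords p = (let r = (1 / 3) * (2 * p $ 1 + 2 * p $ 2 + 2 * p $ 3 - p $ 4 - p $ 5) in
     vector [p $ 1 - r, p $ 2 - r, p $ 3 - r, (1 / 2) * (r + p $ 4 - p $ 5), (1 / 2) * (r - p $ 4 + p $ 5)])"

lemma thomae_coords_mult [simp]: "thomae_coords (w v* thomae_matrix) = w"
  by (simp add: vec_eq_5 thomae_coords_def Let_def field_simps)

lemma mult_thomae_coords [simp]: "thomae_coords p v* thomae_matrix = p"
  by (simp add: vec_eq_5 thomae_coords_def Let_def field_simps)

lemma polynomial_map_thomae_coords: "polynomial_map thomae_coords"
  unfolding polynomial_map_def forall_5 thomae_coords_def Let_def vector_5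
  by (intro conjI polynomial_functions.mult polynomial_functions_diff polynomial_functions.add
      polynomial_functions.const polynomial_functions.coord)

lemma in_thomae_group_iff:
  "g \<in> thomae_group \<longleftrightarrow>
     (\<exists>\<sigma>. \<sigma> permutes UNIV \<and> g = (\<lambda>p. permute_coords \<sigma> (thomae_coords p) v* thomae_matrix))"
proof
  assume "g \<in> thomae_group"
  then obtain \<sigma> where \<sigma>: "\<sigma> permutes UNIV" and g: "\<And>w. g (w v* thomae_matrix) = permute_coords \<sigma> w v* thomae_matrix"
    unfolding thomae_group_def by blast
  have "g p = permute_coords \<sigma> (thomae_coords p) v* thomae_matrix" for p
    using g[of "thomae_coords p"] by (simp only: mult_thomae_coords)
  then show "\<exists>\<sigma>. \<sigma> permutes UNIV \<and> g = (\<lambda>p. permute_coords \<sigma> (thomae_coords p) v* thomae_matrix)"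
    using \<sigma> by blast
next
  assume "\<exists>\<sigma>. \<sigma> permutes UNIV \<and> g = (\<lambda>p. permute_coords \<sigma> (thomae_coords p) v* thomae_matrix)"
  then show "g \<in> thomae_group" unfolding thomae_group_def by auto
qed

lemma thomae_group_eq:
  "thomae_group = {\<lambda>p. permute_coords \<sigma> (thomae_coords p) v* thomae_matrix |\<sigma>. \<sigma> permutes UNIV}"
  by (rule set_eqI) (simp only: in_thomae_group_iff mem_Collect_eq conj_commute)

text \<open>The second condition doubles \<open>xy + yz + zx + u\<^sup>2 + uv + v\<^sup>2 + u + v = 1\<close>, written for an arbitrary
  choice \<open>T\<close> of the three coordinates that play the role of \<open>x, y, z\<close>.\<close>

definition thomae_quadric :: "5 set \<Rightarrow> (complex^5) set" where
  "thomae_quadric T = {w. (\<Sum>i\<in>T. w $ i) = 2 \<and>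
     (\<Sum>i\<in>T. w $ i)\<^sup>2 - (\<Sum>i\<in>T. (w $ i)\<^sup>2) + (\<Sum>i\<in>- T. w $ i)\<^sup>2 + (\<Sum>i\<in>- T. (w $ i)\<^sup>2)
       + 2 * (\<Sum>i\<in>- T. w $ i) = 2}"

definition thomae_variety :: "5 set \<Rightarrow> (complex^5) set" where
  "thomae_variety T = (\<lambda>w. w v* thomae_matrix) ` thomae_quadric T"

lemma in_thomae_variety_iff: "p \<in> thomae_variety T \<longleftrightarrow> thomae_coords p \<in> thomae_quadric T"
proof
  assume "p \<in> thomae_variety T"
  then obtain w where w: "p = w v* thomae_matrix" "w \<in> thomae_quadric T"
    unfolding thomae_variety_def by (rule imageE)
  show "thomae_coords p \<in> thomae_quadric T" unfolding w(1) thomae_coords_mult by (rule w(2))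
next
  assume "thomae_coords p \<in> thomae_quadric T"
  then have "thomae_coords p v* thomae_matrix \<in> thomae_variety T"
    unfolding thomae_variety_def by (rule imageI)
  then show "p \<in> thomae_variety T" by (simp only: mult_thomae_coords)
qed

lemma permute_coords_inverse:
  assumes "bij \<sigma>"
  shows "permute_coords \<sigma> (permute_coords (inv \<sigma>) w) = w" "permute_coords (inv \<sigma>) (permute_coords \<sigma> w) = w"
  by (simp_all add: vec_eq_iff inv_f_f[OF bij_is_inj[OF assms]] surj_f_inv_f[OF bij_is_surj[OF assms]])

text \<open>The quadric depends on \<open>w\<close> only through power sums over \<open>T\<close>
  and its complement. The permuted point has the coordinate \<open>w $ \<sigma> i\<close> at
  \<open>i\<close>, so reindexing turns these sets into their preimages.\<close>

lemma permute_coords_thomae_quadric: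
  assumes "bij \<sigma>"
  shows "permute_coords \<sigma> ` thomae_quadric T = thomae_quadric (\<sigma> -` T)"
proof -
  have bij: "bij_betw \<sigma> (\<sigma> -` A) A" for A
    unfolding bij_betw_def
    using inj_on_subset[OF bij_is_inj[OF assms] subset_UNIV] surj_image_vimage_eq[OF bij_is_surj[OF assms]] ..
  have s: "(\<Sum>i\<in>\<sigma> -` A. w $ \<sigma> i) = (\<Sum>i\<in>A. w $ i)"
    "(\<Sum>i\<in>\<sigma> -` A. (w $ \<sigma> i)\<^sup>2) = (\<Sum>i\<in>A. (w $ i)\<^sup>2)" for A and w :: "complex^5"
    by (rule sum.reindex_bij_betw[OF bij])+
  have *: "permute_coords \<sigma> w \<in> thomae_quadric (\<sigma> -` T) \<longleftrightarrow> w \<in> thomae_quadric T" for w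
    unfolding thomae_quadric_def mem_Collect_eq vec_lambda_beta vimage_Compl[symmetric] s ..
  show ?thesis
  proof
    show "permute_coords \<sigma> ` thomae_quadric T \<subseteq> thomae_quadric (\<sigma> -` T)" using * by blast
    show "thomae_quadric (\<sigma> -` T) \<subseteq> permute_coords \<sigma> ` thomae_quadric T"
    proof
      fix w assume "w \<in> thomae_quadric (\<sigma> -` T)"
      then have "permute_coords (inv \<sigma>) w \<in> thomae_quadric T"
        using *[of "permute_coords (inv \<sigma>) w"] by (simp only: permute_coords_inverse(1)[OF assms])
      then show "w \<in> permute_coords \<sigma> ` thomae_quadric T"
        by (rule rev_image_eqI) (rule permute_coords_inverse(1)[OF assms, symmetric])
    qed
  qed
qed

lemma thomae_group_image:
  assumes "bij \<sigma>"
  shows "(\<lambda>p. permute_coords \<sigma> (thomae_coords p) v* thomae_matrix) ` thomae_variety T = thomae_variety (\<sigma> -` T)"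
  unfolding thomae_variety_def image_image thomae_coords_mult
  by (simp only: permute_coords_thomae_quadric[OF assms, symmetric] image_image)

lemma image_setcompr: "f ` {g x |x. P x} = {f (g x) |x. P x}"
  by blast

lemma thomae_orbit_thomae_variety:
  "thomae_orbit (thomae_variety T) = {thomae_variety (\<sigma> -` T) |\<sigma>. \<sigma> permutes UNIV}"
proof -
  let ?g = "\<lambda>\<sigma> p. permute_coords \<sigma> (thomae_coords p) v* thomae_matrix"
  have "thomae_orbit (thomae_variety T) = {?g \<sigma> ` thomae_variety T |\<sigma>. \<sigma> permutes UNIV}"
    unfolding thomae_orbit_def thomae_group_eq image_setcompr ..
  also have "\<dots> = {thomae_variety (\<sigma> -` T) |\<sigma>. \<sigma> permutes UNIV}"
  proof (intro Collect_cong ex_cong1)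
    fix W \<sigma>
    show "W = ?g \<sigma> ` thomae_variety T \<and> \<sigma> permutes UNIV \<longleftrightarrow> W = thomae_variety (\<sigma> -` T) \<and> \<sigma> permutes UNIV"
      using thomae_group_image[OF permutes_bij[of \<sigma> UNIV], of T] by (cases "\<sigma> permutes UNIV") (simp_all only: simp_thms)
  qed
  finally show ?thesis .
qed

section \<open>The three parametric varieties in the new coordinates\<close>

lemma Compl_5:
  "- {1, 2, 3 :: 5} = {4, 5}" "- {1, 2, 4 :: 5} = {3, 5}" "- {3, 4, 5 :: 5} = {1, 2}"
  using UNIV_5 by auto

text \<open>The symmetric form of the quadric is twice the parametric equation; comparing
  differences of sides reduces each equivalence to one polynomial identity.\<close>

lemma eq_iff_eq_double:
  fixes a b c d :: complex
  assumes "2 * (a - b) = c - d"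
  shows "a = b \<longleftrightarrow> c = d"
proof -
  have "a = b \<longleftrightarrow> 2 * (a - b) = 0" by simp
  then show ?thesis unfolding assms by simp
qed

lemma thomae_quadric_123_iff:
  "w \<in> thomae_quadric {1, 2, 3} \<longleftrightarrow> w $ 1 + w $ 2 + w $ 3 = 2 \<and>
     (w $ 1 + w $ 2 + w $ 3)\<^sup>2 - ((w $ 1)\<^sup>2 + (w $ 2)\<^sup>2 + (w $ 3)\<^sup>2) + (w $ 4 + w $ 5)\<^sup>2 +
     ((w $ 4)\<^sup>2 + (w $ 5)\<^sup>2) + 2 * (w $ 4 + w $ 5) = 2"
  by (simp add: thomae_quadric_def Compl_5 add.assoc)

lemma thomae_quadric_124_iff:
  "w \<in> thomae_quadric {1, 2, 4} \<longleftrightarrow> w $ 1 + w $ 2 + w $ 4 = 2 \<and>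
     (w $ 1 + w $ 2 + w $ 4)\<^sup>2 - ((w $ 1)\<^sup>2 + (w $ 2)\<^sup>2 + (w $ 4)\<^sup>2) + (w $ 3 + w $ 5)\<^sup>2 +
     ((w $ 3)\<^sup>2 + (w $ 5)\<^sup>2) + 2 * (w $ 3 + w $ 5) = 2"
  by (simp add: thomae_quadric_def Compl_5 add.assoc)

lemma thomae_quadric_345_iff:
  "w \<in> thomae_quadric {3, 4, 5} \<longleftrightarrow> w $ 3 + w $ 4 + w $ 5 = 2 \<and>
     (w $ 3 + w $ 4 + w $ 5)\<^sup>2 - ((w $ 3)\<^sup>2 + (w $ 4)\<^sup>2 + (w $ 5)\<^sup>2) + (w $ 1 + w $ 2)\<^sup>2 +
     ((w $ 1)\<^sup>2 + (w $ 2)\<^sup>2) + 2 * (w $ 1 + w $ 2) = 2"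
  by (simp add: thomae_quadric_def Compl_5 add.assoc)

lemma eq_thomae_varietyI:
  assumes "\<And>w. w v* thomae_matrix \<in> V \<longleftrightarrow> w \<in> thomae_quadric T"
  shows "V = thomae_variety T"
  using assms by (metis in_thomae_variety_iff mult_thomae_coords subsetI subset_antisym)

lemma variety_i_eq: "variety_i = thomae_variety {1, 2, 3}"
proof (rule eq_thomae_varietyI)
  fix w :: "complex^5"
  obtain x y z u v where w: "w $ 1 = x" "w $ 2 = y" "w $ 3 = z" "w $ 4 = u" "w $ 5 = v" by blast
  \<comment> \<open>The excess \<open>d + e - a - b - c\<close> is \<open>x + y + z\<close> in the
    new coordinates.\<close>
  have lin: "(x + y + z + 2 * u + v) + (x + y + z + u + 2 * v) - (x + u + v) - (y + u + v) - (z + u + v) = x + y + z"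
    by simp
  show "w v* thomae_matrix \<in> variety_i \<longleftrightarrow> w \<in> thomae_quadric {1, 2, 3}"
    unfolding variety_i_iff thomae_quadric_123_iff vector_thomae_matrix w lin conj_commute[of _ "x + y + z = 2"]
  proof (intro conj_cong refl eq_iff_eq_double, goal_cases)
    case 1
    \<comment> \<open>The two quadratic equations match only modulo the linear one, so
      \<open>z\<close> is eliminated.\<close>
    then have z: "z = 2 - x - y" by (simp add: algebra_simps)
    show ?case unfolding z by (simp add: field_simps power2_eq_square)
  qed
qed

lemma variety_ii_eq: "variety_ii = thomae_variety {1, 2, 4}"
proof (rule eq_thomae_varietyI)
  fix w :: "complex^5"
  obtain x y z u v where w: "w $ 1 = x" "w $ 2 = y" "w $ 3 = z" "w $ 4 = u" "w $ 5 = v" by blast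
  show "w v* thomae_matrix \<in> variety_ii \<longleftrightarrow> w \<in> thomae_quadric {1, 2, 4}"
    unfolding variety_ii_iff thomae_quadric_124_iff vector_thomae_matrix w
  proof (rule conj_cong)
    show "x + y + z + 2 * u + v = z + u + v + 2 \<longleftrightarrow> x + y + u = 2"
      by (simp add: algebra_simps)
  next
    assume "x + y + u = 2"
    then have u: "u = 2 - x - y" by (simp add: algebra_simps)
    show "(x + u + v - 1) * (y + u + v - 1) =
        (x + u + v - 1 + (y + u + v - 1) - (x + y + z + u + 2 * v - 1)) * (z + u + v) \<longleftrightarrow>
      (x + y + u)\<^sup>2 - (x\<^sup>2 + y\<^sup>2 + u\<^sup>2) + (z + v)\<^sup>2 + (z\<^sup>2 + v\<^sup>2) + 2 * (z + v) = 2"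
      unfolding u by (rule eq_iff_eq_double) (simp add: field_simps power2_eq_square)
  qed
qed

lemma variety_iii_eq: "variety_iii = thomae_variety {3, 4, 5}"
proof (rule eq_thomae_varietyI)
  fix w :: "complex^5"
  obtain x y z u v where w: "w $ 1 = x" "w $ 2 = y" "w $ 3 = z" "w $ 4 = u" "w $ 5 = v" by blast
  show "w v* thomae_matrix \<in> variety_iii \<longleftrightarrow> w \<in> thomae_quadric {3, 4, 5}"
    unfolding variety_iii_iff thomae_quadric_345_iff vector_thomae_matrix w
      eq_commute[of "(x + u + v - 1) * (y + u + v - 1)"]
  proof (intro conj_cong refl eq_iff_eq_double, goal_cases)
    case 1
    then have v: "v = 2 - z - u" by (simp add: algebra_simps)
    show ?case unfolding v by (simp add: field_simps power2_eq_square)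
  qed
qed

text \<open>After translating the vertex to the origin the quadric reads
  \<open>u\<^sup>2 + uv + v\<^sup>2 = x\<^sup>2 + xy + y\<^sup>2\<close>; a difference of two values of the same quadratic form \<open>q\<close> is the
  polar form of \<open>q\<close> at the sum and the difference of the arguments.\<close>

definition cone_coords :: "complex^5 \<Rightarrow> complex^5" where
  "cone_coords w = vector [w $ 1 + w $ 2 + w $ 3 - 2,
     w $ 4 - w $ 1 + 1,
     (w $ 4 + w $ 1 - 1 / 3) + (1 / 2) * (w $ 5 + w $ 2 - 1 / 3),
     w $ 2 - w $ 5 - 1,
     (1 / 2) * (w $ 4 + w $ 1 - 1 / 3) + (w $ 5 + w $ 2 - 1 / 3)]"

text \<open>\<open>n1\<close> and \<open>n2\<close> are \<open>u + x - 1/3\<close> and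
  \<open>v + y - 1/3\<close>. The vertex has \<open>x = y = z = 2/3\<close> and
  \<open>u = v = -1/3\<close>; it is the parameter point \<open>(0, 0, 0; 1, 1)\<close>.\<close>

definition cone_coords_inv :: "complex^5 \<Rightarrow> complex^5" where
  "cone_coords_inv p =
    (let n1 = (1 / 3) * (4 * p $ 3 - 2 * p $ 5); n2 = (1 / 3) * (4 * p $ 5 - 2 * p $ 3);
         x = (1 / 2) * (n1 - p $ 2) + 2 / 3; y = (1 / 2) * (n2 + p $ 4) + 2 / 3
     in vector [x, y, p $ 1 + 2 - x - y, (1 / 2) * (n1 + p $ 2) - 1 / 3, (1 / 2) * (n2 - p $ 4) - 1 / 3])"

lemma cone_coords_inverse [simp]: "cone_coords (cone_coords_inv p) = p" "cone_coords_inv (cone_coords w) = w"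
  by (simp_all add: vec_eq_5 cone_coords_def cone_coords_inv_def Let_def field_simps)

lemma polynomial_map_cone_coords: "polynomial_map cone_coords" "polynomial_map cone_coords_inv"
  unfolding polynomial_map_def forall_5 cone_coords_def cone_coords_inv_def Let_def vector_5
  by (intro conjI polynomial_functions.mult polynomial_functions_diff polynomial_functions.add
      polynomial_functions.const polynomial_functions.coord)+

lemma thomae_quadric_eq_cone: "thomae_quadric {1, 2, 3} = cone_coords_inv ` quadric_cone"
proof -
  have "w \<in> thomae_quadric {1, 2, 3} \<longleftrightarrow> cone_coords w \<in> quadric_cone" for w
  proof -
    obtain x y z u v where w: "w $ 1 = x" "w $ 2 = y" "w $ 3 = z" "w $ 4 = u" "w $ 5 = v" by blast
    have "cone_coords w \<in> quadric_cone \<longleftrightarrow> w \<in> thomae_quadric {1, 2, 3}"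
      unfolding thomae_quadric_123_iff quadric_cone_def mem_Collect_eq cone_coords_def vector_5 w
    proof (rule conj_cong)
      assume "x + y + z = 2"
      then have z: "z = 2 - x - y" by (simp add: algebra_simps)
      show "(u - x + 1) * (u + x - 1 / 3 + 1 / 2 * (v + y - 1 / 3)) =
          (y - v - 1) * (1 / 2 * (u + x - 1 / 3) + (v + y - 1 / 3)) \<longleftrightarrow>
          (x + y + z)\<^sup>2 - (x\<^sup>2 + y\<^sup>2 + z\<^sup>2) + (u + v)\<^sup>2 + (u\<^sup>2 + v\<^sup>2) + 2 * (u + v) = 2"
        unfolding z by (rule eq_iff_eq_double) (simp add: field_simps power2_eq_square)
    qed simp
    then show ?thesis by simp
  qed
  note iff = this
  show ?thesis
  proof (intro set_eqI iffI)
    fix w assume "w \<in> thomae_quadric {1, 2, 3}"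
    then have "cone_coords w \<in> quadric_cone" by (simp only: iff)
    then show "w \<in> cone_coords_inv ` quadric_cone"
      by (rule rev_image_eqI) (rule cone_coords_inverse(2)[symmetric])
  next
    fix w assume "w \<in> cone_coords_inv ` quadric_cone"
    then obtain p where "w = cone_coords_inv p" "p \<in> quadric_cone" by (rule imageE)
    then show "w \<in> thomae_quadric {1, 2, 3}" by (simp only: iff cone_coords_inverse)
  qed
qed

section \<open>Geometry of the members of the orbit\<close>

text \<open>Translates of subspaces are closed under affine combinations; this is the property by
  which the cone is told apart from a plane.\<close>

lemma three_plane_add_diff:
  assumes "three_plane W" "x \<in> W" "y \<in> W" "z \<in> W"
  shows "x + y - z \<in> W"
proof -
  obtain S p where S: "vec.subspace S" and W: "W = (+) p ` S"
    using assms(1) unfolding three_plane_def by blast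
  from assms(2-4) W obtain a b c where "a \<in> S" "b \<in> S" "c \<in> S" "x = p + a" "y = p + b" "z = p + c"
    by blast
  moreover from this have "a + b - c \<in> S" using S by (intro vec.subspace_diff vec.subspace_add)
  moreover have "p + a + (p + b) - (p + c) = p + (a + b - c)" by (simp add: algebra_simps)
  ultimately show ?thesis unfolding W by blast
qed

text \<open>\<open>L\<close> maps the cone onto the member and has the polynomial inverse
  \<open>L'\<close>, so irreducibility and dimension carry over. Being affine, \<open>L\<close> also
  commutes with \<open>x + y - z\<close>.\<close>

lemma thomae_variety_properties:
  assumes "\<sigma> permutes (UNIV :: 5 set)"
  shows "algebraic_variety (thomae_variety (\<sigma> -` {1, 2, 3}))"
    and "variety_dim (thomae_variety (\<sigma> -` {1, 2, 3})) = 3"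
    and "\<not> three_plane (thomae_variety (\<sigma> -` {1, 2, 3}))"
proof -
  have bij: "bij \<sigma>" using assms by (rule permutes_bij)
  define L where "L p = permute_coords \<sigma> (cone_coords_inv p) v* thomae_matrix" for p
  define L' where "L' q = cone_coords (permute_coords (inv \<sigma>) (thomae_coords q))" for q
  have L: "thomae_variety (\<sigma> -` {1, 2, 3}) = L ` quadric_cone"
    unfolding thomae_variety_def L_def
    by (simp only: permute_coords_thomae_quadric[OF bij, symmetric] thomae_quadric_eq_cone image_image)
  have poly: "polynomial_map L" "polynomial_map L'"
    unfolding L_def L'_def
    by (intro polynomial_map_compose[OF polynomial_map_vector_matrix_mult]
        polynomial_map_compose[OF polynomial_map_permute_coords]
        polynomial_map_compose[OF polynomial_map_cone_coords(1)]
        polynomial_map_cone_coords polynomial_map_thomae_coords)+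
  have inverse: "L (L' p) = p" "L' (L p) = p" for p
    by (simp_all only: L_def L'_def cone_coords_inverse thomae_coords_mult mult_thomae_coords
        permute_coords_inverse[OF bij])
  show "algebraic_variety (thomae_variety (\<sigma> -` {1, 2, 3}))"
    unfolding L by (rule algebraic_variety_image[OF poly inverse algebraic_variety_cone])
  show "variety_dim (thomae_variety (\<sigma> -` {1, 2, 3})) = 3"
    unfolding L variety_dim_image[OF poly inverse] by (rule variety_dim_cone)
  have "cone_coords_inv (x + y - z) = cone_coords_inv x + cone_coords_inv y - cone_coords_inv z" for x y z
    by (simp add: vec_eq_5 cone_coords_inv_def Let_def field_simps)
  note cone_coords_inv_affine = this
  have affine: "L (x + y - z) = L x + L y - L z" for x y z
    unfolding L_def cone_coords_inv_affine by (simp add: vec_eq_5 algebra_simps)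
  \<comment> \<open>Both \<open>e 2\<close> and \<open>e 3\<close> lie on the cone, but their sum
    has \<open>p2 p3 = 1\<close> and \<open>p4 p5 = 0\<close>.\<close>
  define e :: "5 \<Rightarrow> complex^5" where "e i = axis i 1" for i
  have e: "e 2 \<in> quadric_cone" "e 3 \<in> quadric_cone" "0 \<in> quadric_cone" "e 2 + e 3 - 0 \<notin> quadric_cone"
    by (simp_all add: quadric_cone_def e_def axis_def)
  show "\<not> three_plane (thomae_variety (\<sigma> -` {1, 2, 3}))"
  proof
    assume "three_plane (thomae_variety (\<sigma> -` {1, 2, 3}))"
    then have "three_plane (L ` quadric_cone)" by (simp only: L)
    then have "L (e 2) + L (e 3) - L 0 \<in> L ` quadric_cone"
      by (rule three_plane_add_diff) (intro imageI e)+
    then obtain q where q: "L (e 2 + e 3 - 0) = L q" "q \<in> quadric_cone"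
      unfolding affine[symmetric] by (rule imageE)
    from q(1) have "L' (L (e 2 + e 3 - 0)) = L' (L q)" by (rule arg_cong)
    then have "q = e 2 + e 3 - 0" by (simp only: inverse)
    then show False using q(2) e(4) by (simp only:)
  qed
qed

section \<open>Classes under separate permutations\<close>

definition separate_permutation :: "(5 \<Rightarrow> 5) \<Rightarrow> bool" where
  "separate_permutation \<tau> \<longleftrightarrow> \<tau> permutes UNIV \<and> \<tau> ` {1, 2, 3} = {1, 2, 3} \<and> \<tau> ` {4, 5} = {4, 5}"

lemma separate_permutations_eq: "separate_permutations = {permute_coords \<tau> |\<tau>. separate_permutation \<tau>}"
  unfolding separate_permutations_def separate_permutation_def by blast

lemma separate_permutation_id: "separate_permutation id"
  by (simp add: separate_permutation_def permutes_id)

lemma separate_permutation_comp: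
  "separate_permutation \<tau> \<Longrightarrow> separate_permutation \<rho> \<Longrightarrow> separate_permutation (\<tau> \<circ> \<rho>)"
  unfolding separate_permutation_def by (metis image_comp permutes_compose)

lemma separate_permutation_inv: "separate_permutation \<tau> \<Longrightarrow> separate_permutation (inv \<tau>)"
  unfolding separate_permutation_def by (metis image_inv_f_f permutes_inj permutes_inv)

lemma separate_permutation_transpose:
  fixes i j :: 5
  shows "(i \<in> {1, 2, 3} \<and> j \<in> {1, 2, 3}) \<or> (i \<in> {4, 5} \<and> j \<in> {4, 5}) \<Longrightarrow> separate_permutation (Transposition.transpose i j)"
  unfolding separate_permutation_def by (auto intro: permutes_swap_id)

lemma separate_perm_rel_Image: "separate_perm_rel `` {V} = {h ` V |h. h \<in> separate_permutations}"
  unfolding separate_perm_rel_def by auto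

lemma separate_perm_rel_self: "V \<in> separate_perm_rel `` {V}"
proof -
  have "permute_coords id ` V = V" by simp
  then show ?thesis
    unfolding separate_perm_rel_Image separate_permutations_eq using separate_permutation_id by blast
qed

lemma separate_perm_rel_Image_subset:
  assumes "separate_permutation \<tau>"
  shows "separate_perm_rel `` {permute_coords \<tau> ` V} \<subseteq> separate_perm_rel `` {V}"
proof
  fix W assume "W \<in> separate_perm_rel `` {permute_coords \<tau> ` V}"
  then obtain \<rho> where \<rho>: "separate_permutation \<rho>" "W = permute_coords \<rho> ` permute_coords \<tau> ` V"
    unfolding separate_perm_rel_Image separate_permutations_eq by blast
  have "W = permute_coords (\<tau> \<circ> \<rho>) ` V" unfolding \<rho>(2) image_image by simp
  then show "W \<in> separate_perm_rel `` {V}"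
    using separate_permutation_comp[OF assms \<rho>(1)]
    unfolding separate_perm_rel_Image separate_permutations_eq by blast
qed

text \<open>Separate permutations are closed under composition and inverses, so a set and its image
  have the same images.\<close>

lemma separate_perm_rel_Image_eq:
  assumes "separate_permutation \<tau>"
  shows "separate_perm_rel `` {permute_coords \<tau> ` V} = separate_perm_rel `` {V}"
proof
  have "bij \<tau>" using assms by (auto simp: separate_permutation_def permutes_bij)
  then have "permute_coords (inv \<tau>) ` permute_coords \<tau> ` V = V"
    unfolding image_image by (simp only: permute_coords_inverse image_ident)
  then show "separate_perm_rel `` {V} \<subseteq> separate_perm_rel `` {permute_coords \<tau> ` V}"
    using separate_perm_rel_Image_subset[OF separate_permutation_inv[OF assms], of "permute_coords \<tau> ` V"]
    by simp
qed (rule separate_perm_rel_Image_subset[OF assms])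

text \<open>An upper parameter is its own coordinate plus \<open>u + v\<close>, a lower one its own
  coordinate plus the sum of all five. Both sums are invariant, so permuting parameters and
  permuting coordinates is the same.\<close>

lemma separate_permutation_thomae_matrix:
  assumes "separate_permutation \<tau>"
  shows "permute_coords \<tau> w v* thomae_matrix = permute_coords \<tau> (w v* thomae_matrix)"
proof -
  have \<tau>: "bij \<tau>" "\<tau> ` {1, 2, 3} = {1, 2, 3}" "\<tau> ` {4, 5} = {4, 5}"
    using assms by (auto simp: separate_permutation_def permutes_bij)
  have up: "(q v* thomae_matrix) $ i = q $ i + (\<Sum>j\<in>{4, 5}. q $ j)" if "i \<in> {1, 2, 3}" for i :: 5 and q
    using that by auto
  have low: "(q v* thomae_matrix) $ i = q $ i + (\<Sum>j\<in>{1, 2, 3}. q $ j) + (\<Sum>j\<in>{4, 5}. q $ j)" if "i \<in> {4, 5}" for i :: 5 and q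
    using that by auto
  have "inj_on \<tau> A" for A using \<tau>(1) by (meson bij_is_inj inj_on_subset subset_UNIV)
  then have sum: "(\<Sum>j\<in>A. w $ \<tau> j) = (\<Sum>j\<in>\<tau> ` A. w $ j)" for A by (simp add: sum.reindex)
  show ?thesis
    unfolding vec_eq_iff
  proof
    fix i :: 5
    have "i \<in> {1, 2, 3} \<or> i \<in> {4, 5}" using exhaust_5[of i] by blast
    then show "(permute_coords \<tau> w v* thomae_matrix) $ i = permute_coords \<tau> (w v* thomae_matrix) $ i"
    proof
      assume i: "i \<in> {1, 2, 3}"
      then have "\<tau> i \<in> {1, 2, 3}" using \<tau>(2) by blast
      then show ?thesis unfolding vec_lambda_beta up[OF i] up[OF \<open>\<tau> i \<in> _\<close>] sum \<tau> by simp
    next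
      assume i: "i \<in> {4, 5}"
      then have "\<tau> i \<in> {4, 5}" using \<tau>(3) by blast
      then show ?thesis unfolding vec_lambda_beta low[OF i] low[OF \<open>\<tau> i \<in> _\<close>] sum \<tau> by simp
    qed
  qed
qed

lemma permute_coords_thomae_variety:
  assumes "separate_permutation \<tau>"
  shows "permute_coords \<tau> ` thomae_variety T = thomae_variety (\<tau> -` T)"
proof -
  have "bij \<tau>" using assms by (auto simp: separate_permutation_def permutes_bij)
  have "permute_coords \<tau> ` thomae_variety T = (\<lambda>w. w v* thomae_matrix) ` permute_coords \<tau> ` thomae_quadric T"
    unfolding thomae_variety_def image_image separate_permutation_thomae_matrix[OF assms] ..
  also have "\<dots> = thomae_variety (\<tau> -` T)"
    unfolding thomae_variety_def permute_coords_thomae_quadric[OF \<open>bij \<tau>\<close>] ..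
  finally show ?thesis .
qed

text \<open>Separate permutations act transitively on the triples that meet \<open>{1, 2, 3}\<close>
  in a given number of elements; the numbers 3, 2, 1 lead to (i), (ii), (iii).\<close>

lemma thomae_variety_cases:
  assumes "card (T :: 5 set) = 3"
  obtains \<tau> where "separate_permutation \<tau>"
    "thomae_variety T = permute_coords \<tau> ` variety_i \<or> thomae_variety T = permute_coords \<tau> ` variety_ii \<or>
     thomae_variety T = permute_coords \<tau> ` variety_iii"
proof -
  \<comment> \<open>Encoding membership by five truth values leaves a finite case distinction, in
    which ten triples survive.\<close>
  define b1 b2 b3 b4 b5 where "b1 \<longleftrightarrow> 1 \<in> T" and "b2 \<longleftrightarrow> 2 \<in> T" and "b3 \<longleftrightarrow> 3 \<in> T" and "b4 \<longleftrightarrow> 4 \<in> T"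
    and "b5 \<longleftrightarrow> 5 \<in> T"
  note b = this[symmetric]
  have "i \<in> T \<longleftrightarrow> i \<in> (if b5 then {5} else {}) \<union> (if b4 then {4} else {}) \<union> (if b3 then {3} else {}) \<union>
      (if b2 then {2} else {}) \<union> (if b1 then {1} else {})" for i
    using exhaust_5[of i] by (elim disjE) (simp_all add: b)
  then have T: "T = (if b5 then {5} else {}) \<union> (if b4 then {4} else {}) \<union> (if b3 then {3} else {}) \<union>
      (if b2 then {2} else {}) \<union> (if b1 then {1} else {})"
    by (rule set_eqI)
  have "card T = (\<Sum>i\<in>UNIV. if i \<in> T then 1 else 0)" by (simp add: sum.If_cases)
  then have c: "(if b1 then 1 else 0) + (if b2 then 1 else 0) + (if b3 then 1 else 0) + (if b4 then 1 else 0) +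
      (if b5 then 1 else 0) = (3 :: nat)"
    unfolding sum_5 b assms by (rule sym)
  have "T = {1,2,3} \<or> T = {1,2,4} \<or> T = {1,2,5} \<or> T = {1,3,4} \<or> T = {1,3,5} \<or> T = {2,3,4} \<or> T = {2,3,5} \<or>
      T = {1,4,5} \<or> T = {2,4,5} \<or> T = {3,4,5}"
    unfolding T using c by (cases b1; cases b2; cases b3; cases b4; cases b5) simp_all
  then consider "T = {1, 2, 3}"
    | i j :: 5 where "i \<in> {1, 2, 3}" "j \<in> {4, 5}" "T = insert j ({1, 2, 3} - {i})"
    | i :: 5 where "i \<in> {1, 2, 3}" "T = {i, 4, 5}"
  proof (elim disjE)
    assume T: "T = {1, 2, 4}" show ?thesis by (rule that(2)[of 3 4]) (auto simp: T)
  next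
    assume T: "T = {1, 2, 5}" show ?thesis by (rule that(2)[of 3 5]) (auto simp: T)
  next
    assume T: "T = {1, 3, 4}" show ?thesis by (rule that(2)[of 2 4]) (auto simp: T)
  next
    assume T: "T = {1, 3, 5}" show ?thesis by (rule that(2)[of 2 5]) (auto simp: T)
  next
    assume T: "T = {2, 3, 4}" show ?thesis by (rule that(2)[of 1 4]) (auto simp: T)
  next
    assume T: "T = {2, 3, 5}" show ?thesis by (rule that(2)[of 1 5]) (auto simp: T)
  next
    assume T: "T = {1, 4, 5}" show ?thesis by (rule that(3)[of 1]) (auto simp: T)
  next
    assume T: "T = {2, 4, 5}" show ?thesis by (rule that(3)[of 2]) (auto simp: T)
  next
    assume T: "T = {3, 4, 5}" show ?thesis by (rule that(3)[of 3]) (auto simp: T)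
  qed (rule that(1))
  then show ?thesis
  proof cases
    case 1
    have "thomae_variety T = permute_coords id ` variety_i" by (simp add: 1 variety_i_eq)
    then show ?thesis using that separate_permutation_id by blast
  next
    case (2 i j)
    \<comment> \<open>Exchanges the missing upper index \<open>i\<close> with 3 and the lower index
      \<open>j\<close> with 4, to match the model \<open>{1, 2, 4}\<close>.\<close>
    define \<tau> where "\<tau> = Transposition.transpose i 3 \<circ> Transposition.transpose j 4"
    have \<tau>: "separate_permutation \<tau>"
      unfolding \<tau>_def using 2 by (intro separate_permutation_comp separate_permutation_transpose) auto
    have "\<tau> -` {1, 2, 4} = T"
    proof (intro set_eqI)
      fix k :: 5
      show "k \<in> \<tau> -` {1, 2, 4} \<longleftrightarrow> k \<in> T"
        using 2(1,2) exhaust_5[of k] unfolding 2(3) \<tau>_def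
        by (elim insertE emptyE disjE; simp add: Transposition.transpose_def)
    qed
    then have "thomae_variety T = permute_coords \<tau> ` variety_ii"
      by (simp only: variety_ii_eq permute_coords_thomae_variety[OF \<tau>])
    then show ?thesis using that \<tau> by blast
  next
    case (3 i)
    define \<tau> where "\<tau> = Transposition.transpose i 3"
    have \<tau>: "separate_permutation \<tau>"
      unfolding \<tau>_def using 3 by (intro separate_permutation_transpose) auto
    have "\<tau> -` {3, 4, 5} = T"
    proof (intro set_eqI)
      fix k :: 5
      show "k \<in> \<tau> -` {3, 4, 5} \<longleftrightarrow> k \<in> T"
        using 3(1) exhaust_5[of k] unfolding 3(2) \<tau>_def
        by (elim insertE emptyE disjE; simp add: Transposition.transpose_def)
    qed
    then have "thomae_variety T = permute_coords \<tau> ` variety_iii"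
      by (simp only: variety_iii_eq permute_coords_thomae_variety[OF \<tau>])
    then show ?thesis using that \<tau> by blast
  qed
qed

text \<open>Two properties that survive separate permutations decide: on (i) the excess
  \<open>d + e - a - b - c\<close> is 2, and on (iii) some upper parameter is 2.\<close>

lemma not_separate_perm_image:
  assumes "h \<in> separate_permutations"
  shows "variety_ii \<noteq> h ` variety_i" "variety_iii \<noteq> h ` variety_i" "variety_ii \<noteq> h ` variety_iii"
proof -
  obtain \<tau> where h: "h = permute_coords \<tau>" and \<tau>: "bij \<tau>" "\<tau> ` {1, 2, 3} = {1, 2, 3}" "\<tau> ` {4, 5} = {4, 5}"
    using assms by (auto simp: separate_permutations_eq separate_permutation_def permutes_bij)
  have "inj_on \<tau> A" for A using \<tau>(1) by (meson bij_is_inj inj_on_subset subset_UNIV)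
  then have sum: "(\<Sum>i\<in>A. h p $ i) = (\<Sum>i\<in>\<tau> ` A. p $ i)" for A p by (simp add: sum.reindex h)
  have s: "(\<Sum>i\<in>{4, 5}. q $ i) - (\<Sum>i\<in>{1, 2, 3}. q $ i) = 2" if "q \<in> h ` variety_i" for q
  proof -
    from that obtain p where q: "q = h p" and p: "p \<in> variety_i" by blast
    show ?thesis unfolding q sum \<tau> using p by (simp add: variety_i_iff diff_diff_eq add.assoc)
  qed
  have two: "\<exists>i\<in>{1, 2, 3}. q $ i = 2" if "q \<in> h ` variety_iii" for q
  proof -
    from that obtain p where q: "q = h p" and p: "p \<in> variety_iii" by blast
    have "3 \<in> \<tau> ` {1, 2, 3}" using \<tau>(2) by blast
    then obtain i where "i \<in> {1, 2, 3}" "\<tau> i = 3" by auto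
    then show ?thesis using p by (intro bexI[of _ i]) (simp_all add: q h variety_iii_iff)
  qed
  \<comment> \<open>\<open>p\<close> has excess 1 and no upper parameter equal to 2;
    \<open>q\<close> has excess -1.\<close>
  define p :: "complex^5" where "p = vector [1, 0, 0, 2, 0]"
  define q :: "complex^5" where "q = vector [1, 0, 2, 2, 0]"
  have p: "p \<in> variety_ii" and q: "q \<in> variety_iii" by (simp_all add: p_def q_def variety_ii_iff variety_iii_iff)
  show "variety_ii \<noteq> h ` variety_i" using p s[of p] by (auto simp: p_def)
  show "variety_iii \<noteq> h ` variety_i" using q s[of q] by (auto simp: q_def)
  show "variety_ii \<noteq> h ` variety_iii" using p two[of p] by (auto simp: p_def)
qed

lemma card_triple: "A \<noteq> B \<Longrightarrow> A \<noteq> C \<Longrightarrow> C \<noteq> B \<Longrightarrow> card {A, B, C} = 3"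
  by simp

theorem theorem3p4:
  shows "(\<exists>V. let orb = thomae_orbit V in
      (\<forall>W\<in>orb. algebraic_variety W \<and> variety_dim W = 3 \<and> gamma_quotient_summation W
                 \<and> \<not> three_plane W) \<and>
      variety_i \<in> orb \<and> variety_ii \<in> orb \<and> variety_iii \<in> orb \<and>
      orb // separate_perm_rel =
        {separate_perm_rel `` {variety_i}, separate_perm_rel `` {variety_ii},
         separate_perm_rel `` {variety_iii}} \<and>
      card (orb // separate_perm_rel) = 3) \<and>
    (\<forall>a b c d e :: complex.
      d \<notin> \<int>\<^sub>\<le>\<^sub>0 \<longrightarrow> e \<notin> \<int>\<^sub>\<le>\<^sub>0 \<longrightarrow>
      a * b + b * c + c * a = (d - 1) * (e - 1) \<longrightarrow> d + e - a - b - c = 2 \<longrightarrow>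
      hyp3F2_term a b c d e sums gamma_quotient [d, e] [a + 1, b + 1, c + 1]) \<and>
    (\<forall>a b c e :: complex.
      c + 2 \<notin> \<int>\<^sub>\<le>\<^sub>0 \<longrightarrow> e \<notin> \<int>\<^sub>\<le>\<^sub>0 \<longrightarrow>
      (a - 1) * (b - 1) = ((a - 1) + (b - 1) - (e - 1)) * c \<longrightarrow> Re (e - a - b + 2) > 0 \<longrightarrow>
      hyp3F2_term a b c (c + 2) e sums
        gamma_quotient [e, e - a - b + 2, c + 2] [e - a + 1, e - b + 1, c + 1]) \<and>
    (\<forall>a b d e :: complex.
      d \<notin> \<int>\<^sub>\<le>\<^sub>0 \<longrightarrow> e \<notin> \<int>\<^sub>\<le>\<^sub>0 \<longrightarrow>
      (a - 1) * (b - 1) = (d - 2) * (e - 2) \<longrightarrow> Re (d + e - a - b - 2) > 0 \<longrightarrow>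
      hyp3F2_term a b 2 d e sums ((d - 1) * (e - 1) / (d + e - a - b - 2)))"
proof -
  define orb where "orb = thomae_orbit variety_i"
  have orb: "orb = {thomae_variety (\<sigma> -` {1, 2, 3}) |\<sigma>. \<sigma> permutes UNIV}"
    unfolding orb_def variety_i_eq by (rule thomae_orbit_thomae_variety)
  have cases: "\<exists>\<tau> V. separate_permutation \<tau> \<and> V \<in> {variety_i, variety_ii, variety_iii} \<and> W = permute_coords \<tau> ` V"
    if "W \<in> orb" for W
  proof -
    from that obtain \<sigma> where \<sigma>: "\<sigma> permutes UNIV" and W: "W = thomae_variety (\<sigma> -` {1, 2, 3})"
      unfolding orb by blast
    have "card (\<sigma> -` {1, 2, 3}) = card {1, 2, 3 :: 5}"
      using permutes_inj[OF \<sigma>] permutes_surj[OF \<sigma>] by (intro card_vimage_inj) auto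
    then have "card (\<sigma> -` {1, 2, 3}) = 3" by simp
    from thomae_variety_cases[OF this] show ?thesis unfolding W by (metis insertCI)
  qed
  have members: "variety_i \<in> orb" "variety_ii \<in> orb" "variety_iii \<in> orb"
  proof -
    have "id -` {1, 2, 3 :: 5} = {1, 2, 3}" by simp
    then show "variety_i \<in> orb" unfolding orb variety_i_eq using permutes_id by (metis (mono_tags, lifting) mem_Collect_eq)
    \<comment> \<open>Exchanging \<open>z\<close> with \<open>u\<close> leads to (ii); exchanging
      \<open>x\<close> with \<open>u\<close> and \<open>y\<close> with \<open>v\<close> leads to
      (iii).\<close>
    have "Transposition.transpose 3 4 -` {1, 2, 3 :: 5} = {1, 2, 4}"
      by (auto simp: set_eq_iff Transposition.transpose_def split: if_splits)
    moreover have "Transposition.transpose 3 (4 :: 5) permutes UNIV" by (rule permutes_swap_id) auto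
    ultimately show "variety_ii \<in> orb" unfolding orb variety_ii_eq by (metis (mono_tags, lifting) mem_Collect_eq)
    have "(Transposition.transpose 1 4 \<circ> Transposition.transpose 2 5) -` {1, 2, 3 :: 5} = {3, 4, 5}"
      using exhaust_5 by (auto simp: set_eq_iff Transposition.transpose_def split: if_splits)
    moreover have "(Transposition.transpose 1 4 \<circ> Transposition.transpose 2 (5 :: 5)) permutes UNIV"
      by (intro permutes_compose permutes_swap_id) auto
    ultimately show "variety_iii \<in> orb" unfolding orb variety_iii_eq by (metis (mono_tags, lifting) mem_Collect_eq)
  qed
  have properties: "algebraic_variety W \<and> variety_dim W = 3 \<and> gamma_quotient_summation W \<and> \<not> three_plane W"
    if W: "W \<in> orb" for W
  proof -
    obtain \<tau> V where "separate_permutation \<tau>" "V \<in> {variety_i, variety_ii, variety_iii}" "W = permute_coords \<tau> ` V"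
      using cases[OF W] by blast
    then have "gamma_quotient_summation W"
      using gamma_quotient_summation_variety_i gamma_quotient_summation_variety_ii
        gamma_quotient_summation_variety_iii
      by (auto simp: separate_permutations_eq intro!: gamma_quotient_summation_separate_permutation)
    then show ?thesis using W thomae_variety_properties unfolding orb by blast
  qed
  let ?cls = "\<lambda>V. separate_perm_rel `` {V}"
  have quotient: "orb // separate_perm_rel = {?cls variety_i, ?cls variety_ii, ?cls variety_iii}"
  proof
    show "orb // separate_perm_rel \<subseteq> {?cls variety_i, ?cls variety_ii, ?cls variety_iii}"
    proof
      fix C assume "C \<in> orb // separate_perm_rel"
      then obtain W where W: "W \<in> orb" "C = ?cls W" by (rule quotientE)
      from cases[OF W(1)] obtain \<tau> V where "separate_permutation \<tau>"
        and V: "V \<in> {variety_i, variety_ii, variety_iii}" "W = permute_coords \<tau> ` V" by blast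
      then have "C = ?cls V" by (simp only: W(2) V(2) separate_perm_rel_Image_eq)
      then show "C \<in> {?cls variety_i, ?cls variety_ii, ?cls variety_iii}" using V(1) by blast
    qed
    show "{?cls variety_i, ?cls variety_ii, ?cls variety_iii} \<subseteq> orb // separate_perm_rel"
      using members by (auto intro: quotientI)
  qed
  have neq: "?cls V \<noteq> ?cls W" if "\<And>h. h \<in> separate_permutations \<Longrightarrow> W \<noteq> h ` V" for V W
  proof
    assume "?cls V = ?cls W"
    then have "W \<in> {h ` V |h. h \<in> separate_permutations}"
      using separate_perm_rel_self[of W] by (simp only: separate_perm_rel_Image)
    then show False using that by blast
  qed
  have card: "card (orb // separate_perm_rel) = 3"
    unfolding quotient
    by (rule card_triple) (rule neq, erule not_separate_perm_image)+
  show ?thesis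
    unfolding Let_def
  proof (intro conjI exI[of _ variety_i], unfold orb_def[symmetric])
    show "\<forall>W\<in>orb. algebraic_variety W \<and> variety_dim W = 3 \<and> gamma_quotient_summation W \<and> \<not> three_plane W"
      using properties by (rule ballI)
  qed (intro members quotient card allI impI hyp3F2_i hyp3F2_ii hyp3F2_iii; assumption)+
qed

end
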